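(* Let $N\ge3$ and let $\Omega\subset\mathbb{R}^N$ be an open set with $\overline{\Omega}\subset\mathbb{R}^N_+$. Let $a\in[0,N/2)$, $b\ge0$, and let $u\in W^{2,N}_{loc}(\Omega)\cap C(\overline{\Omega})$ be such that, for some positive constants $C$ and $K$, $$u(x)\le C|x|^{-b}\quad\text{and}\quad -\Delta u\le K\frac{u}{|x|^2}\quad\text{in }\Omega,\qquad u\le0\quad\text{on }\partial\Omega,$$ where $$K\le\frac{N^2}{4}-a^2\quad\text{and}\quad N<2a+2b+2.$$ Then $u\le0$ in $\Omega$.
   Context: $\mathbb{R}^N_+=\{x=(x_1,x')\in\mathbb{R}^N: x_1>0\}$ is the open half space. The differential inequality holds almost everywhere, as $u\in W^{2,N}_{loc}(\Omega)$. *)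

theory Defs
  imports "HOL-Analysis.Analysis"
begin

definition half_space :: "'n \<Rightarrow> (real ^ 'n) set" where
  "half_space k = {x. x $ k > 0}"

definition partial_deriv :: "'n::finite \<Rightarrow> (real ^ 'n \<Rightarrow> real) \<Rightarrow> real ^ 'n \<Rightarrow> real" where
  "partial_deriv i f x = frechet_derivative f (at x) (axis i 1)"

text \<open>A list of coordinate indices plays the role of a multi-index; the order of
  differentiation is irrelevant for the smooth functions to which this is applied.\<close>

definition partial_derivs :: "'n::finite list \<Rightarrow> (real ^ 'n \<Rightarrow> real) \<Rightarrow> real ^ 'n \<Rightarrow> real" where
  "partial_derivs \<alpha> = foldr partial_deriv \<alpha>"

text \<open>Frechet differentiability of all iterated partial derivatives also makes all of them
  continuous, so this is \<open>C\<^sup>\<infinity>\<close> on the whole space.\<close>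

definition smooth_fun :: "(real ^ 'n::finite \<Rightarrow> real) \<Rightarrow> bool" where
  "smooth_fun f \<longleftrightarrow> (\<forall>\<alpha>. partial_derivs \<alpha> f differentiable_on UNIV)"

definition test_functions :: "(real ^ 'n::finite) set \<Rightarrow> (real ^ 'n \<Rightarrow> real) set" where
  "test_functions \<Omega> =
     {\<phi>. smooth_fun \<phi> \<and> compact (closure {x. \<phi> x \<noteq> 0}) \<and> closure {x. \<phi> x \<noteq> 0} \<subseteq> \<Omega>}"

definition Lp_loc :: "real \<Rightarrow> (real ^ 'n::finite) set \<Rightarrow> (real ^ 'n \<Rightarrow> real) set" where
  "Lp_loc p \<Omega> =
     {f. \<forall>S. compact S \<and> S \<subseteq> \<Omega> \<longrightarrow>
           f \<in> borel_measurable (lebesgue_on S) \<and>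
           integrable (lebesgue_on S) (\<lambda>x. \<bar>f x\<bar> powr p)}"

definition has_weak_deriv ::
    "(real ^ 'n::finite) set \<Rightarrow> 'n list \<Rightarrow> (real ^ 'n \<Rightarrow> real) \<Rightarrow> (real ^ 'n \<Rightarrow> real) \<Rightarrow> bool" where
  "has_weak_deriv \<Omega> \<alpha> u v \<longleftrightarrow>
     u \<in> Lp_loc 1 \<Omega> \<and> v \<in> Lp_loc 1 \<Omega> \<and>
     (\<forall>\<phi>\<in>test_functions \<Omega>.
        (LINT x|lebesgue_on \<Omega>. u x * partial_derivs \<alpha> \<phi> x) =
        (- 1) ^ length \<alpha> * (LINT x|lebesgue_on \<Omega>. v x * \<phi> x))"

text \<open>The empty list \<open>\<alpha>\<close> expresses that \<open>u\<close> itself lies in \<open>L\<^sup>p\<^sub>l\<^sub>o\<^sub>c\<close>. Elements are honest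
  functions, not classes modulo null sets; their values outside \<open>\<Omega>\<close> are irrelevant.\<close>

definition Sobolev_loc :: "nat \<Rightarrow> real \<Rightarrow> (real ^ 'n::finite) set \<Rightarrow> (real ^ 'n \<Rightarrow> real) set" where
  "Sobolev_loc m p \<Omega> =
     {u. \<forall>\<alpha>. length \<alpha> \<le> m \<longrightarrow> (\<exists>v\<in>Lp_loc p \<Omega>. has_weak_deriv \<Omega> \<alpha> u v)}"

text \<open>A weak derivative is determined only up to a null set: the function below is a chosen
  representative, meaningful when some weak derivative exists and only almost everywhere.\<close>

definition weak_deriv ::
    "(real ^ 'n::finite) set \<Rightarrow> 'n list \<Rightarrow> (real ^ 'n \<Rightarrow> real) \<Rightarrow> real ^ 'n \<Rightarrow> real" where
  "weak_deriv \<Omega> \<alpha> u = (SOME v. has_weak_deriv \<Omega> \<alpha> u v)"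

definition weak_laplacian ::
    "(real ^ 'n::finite) set \<Rightarrow> (real ^ 'n \<Rightarrow> real) \<Rightarrow> real ^ 'n \<Rightarrow> real" where
  "weak_laplacian \<Omega> u x = (\<Sum>i\<in>UNIV. weak_deriv \<Omega> [i, i] u x)"

end

theory Submission
  imports Defs
begin

text \<open>
  With \<open>N\<close> the dimension and \<open>x\<^sub>1\<close> the coordinate that is positive on the half space, the function
  \<open>x\<^sub>1 |x| powr (a - N/2)\<close> solves \<open>- \<Delta>w = (N\<^sup>2/4 - a\<^sup>2) w / |x|\<^sup>2\<close>, but it degenerates where
  \<open>x\<^sub>1 = 0\<close>, so it cannot be compared with \<open>u\<close> at infinity. Instead one uses
  \<open>w = x\<^sub>1 (A |x| powr (a - N/2) + \<tau> |x| powr (a - N/2 - \<sigma>)) + \<eta> |x| powr (- \<beta>) (1 - M x\<^sub>1\<^sup>2 / |x|\<^sup>2)\<close>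
  with \<open>\<beta> = N/2 - 1 - a + \<sigma> < b\<close>: the second term produces a gain away from \<open>x\<^sub>1 = 0\<close> that absorbs
  the loss caused by the third term, and the third term is a strict supersolution near \<open>x\<^sub>1 = 0\<close>.
  The result is a strict supersolution with \<open>w \<ge> \<eta> |x| powr (- \<beta>)\<close>, so \<open>u / w\<close> tends to \<open>0\<close> at infinity.

  If \<open>u\<close> were positive somewhere, \<open>u / w\<close> would attain a positive maximum \<open>m\<close> at some \<open>x\<^sub>0\<close> in \<open>\<Omega>\<close>,
  and \<open>v = u - m w \<le> 0\<close> would vanish at \<open>x\<^sub>0\<close> while \<open>\<Delta>v \<ge> c > 0\<close> near \<open>x\<^sub>0\<close> in the sense of distributions.
  Testing with smooth truncations of the fundamental solution with pole \<open>x\<^sub>0\<close>, whose Laplacians have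
  negative parts concentrating at \<open>x\<^sub>0\<close>, gives a contradiction.
\<close>

subsection \<open>Smooth functions\<close>

text \<open>The powers of \<open>1 / t\<close> are included because differentiating the standard
  flat function \<open>exp (- (1 / t))\<close> produces them; the whole family is closed under
  differentiation up to linear combinations.\<close>

definition bump_exp :: "nat \<Rightarrow> real \<Rightarrow> real" where
  "bump_exp k t = (if t > 0 then (1 / t) ^ k * exp (- (1 / t)) else 0)"

lemma bump_exp_nonneg: "0 \<le> bump_exp k t"
  by (simp add: bump_exp_def)

lemma bump_exp_tendsto_0: "(bump_exp k \<longlongrightarrow> 0) (at_right 0)"
proof -
  have "((\<lambda>t::real. (inverse t) ^ k / exp (inverse t)) \<longlongrightarrow> 0) (at_right 0)"
    by (rule filterlim_compose[OF tendsto_power_div_exp_0 filterlim_inverse_at_top_right])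
  moreover have "\<forall>\<^sub>F t in at_right 0. (inverse t) ^ k / exp (inverse t) = bump_exp k t"
    using eventually_at_right_less[of "0::real"]
    by eventually_elim (simp add: bump_exp_def exp_minus field_simps)
  ultimately show ?thesis
    using tendsto_cong by fastforce
qed

text \<open>Only \<open>t = 0\<close> needs care: there the right difference quotient is
  \<open>bump_exp (Suc k)\<close>, which tends to 0, and the left one vanishes.\<close>

lemma bump_exp_has_derivative:
  "(bump_exp k has_real_derivative (bump_exp (k + 2) t - real k * bump_exp (k + 1) t)) (at t)"
proof (cases t "0::real" rule: linorder_cases)
  case less
  have "((\<lambda>t. 0) has_real_derivative 0) (at t)" by simp
  then have "(bump_exp k has_real_derivative 0) (at t)"
    by (rule has_field_derivative_transform_within_open[of _ _ _ "{..<0}"])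
      (use less in \<open>auto simp: bump_exp_def\<close>)
  with less show ?thesis by (simp add: bump_exp_def)
next
  case greater
  have eq: "bump_exp (k + 2) t - real k * bump_exp (k + 1) t
      = (real k * (1 / t) ^ (k - 1)) * (- (1 / t\<^sup>2)) * exp (- (1 / t)) + (1 / t) ^ k * (exp (- (1 / t)) * (1 / t\<^sup>2))"
    using greater by (cases k) (auto simp: bump_exp_def field_simps power2_eq_square)
  have "((\<lambda>t. (1 / t) ^ k * exp (- (1 / t))) has_real_derivative
      (bump_exp (k + 2) t - real k * bump_exp (k + 1) t)) (at t)"
    unfolding eq by (rule derivative_eq_intros refl | use greater in \<open>simp add: power2_eq_square\<close>)+
  then show ?thesis
    by (rule has_field_derivative_transform_within_open[of _ _ _ "{0<..}"])
      (use greater in \<open>auto simp: bump_exp_def\<close>)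
next
  case equal
  have "((\<lambda>h. (bump_exp k (0 + h) - bump_exp k 0) / h) \<longlongrightarrow> 0) (at_right 0)"
  proof -
    have "\<forall>\<^sub>F h in at_right 0. bump_exp (Suc k) h = (bump_exp k (0 + h) - bump_exp k 0) / h"
      using eventually_at_right_less[of "0::real"]
      by eventually_elim (simp add: bump_exp_def field_simps)
    with bump_exp_tendsto_0[of "Suc k"] show ?thesis
      using tendsto_cong by fastforce
  qed
  moreover have "((\<lambda>h. (bump_exp k (0 + h) - bump_exp k 0) / h) \<longlongrightarrow> 0) (at_left 0)"
  proof -
    have "\<forall>\<^sub>F h in at_left 0. (bump_exp k (0 + h) - bump_exp k 0) / h = 0"
      using eventually_at_left_field[of "\<lambda>h. (bump_exp k (0 + h) - bump_exp k 0) / h = 0" 0]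
      by (auto simp: bump_exp_def intro!: exI[of _ "-1"])
    then show ?thesis by (rule tendsto_eventually)
  qed
  ultimately have "((\<lambda>h. (bump_exp k (0 + h) - bump_exp k 0) / h) \<longlongrightarrow> 0) (at 0)"
    by (simp add: filterlim_at_split)
  then have "(bump_exp k has_real_derivative 0) (at 0)"
    by (simp add: DERIV_def)
  with equal show ?thesis by (simp add: bump_exp_def)
qed

section \<open>Partial derivatives and an inductive class of smooth functions\<close>

lemma partial_deriv_has_derivative:
  assumes "(f has_derivative f') (at x)"
  shows "partial_deriv i f x = f' (axis i 1)"
  using frechet_derivative_at[OF assms] unfolding partial_deriv_def by simp

lemma has_real_derivative_along_axis:
  assumes "f differentiable (at x)"
  shows "((\<lambda>t. f (x + t *\<^sub>R axis i 1)) has_real_derivative partial_deriv i f x) (at 0)"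
proof -
  obtain f' where f': "(f has_derivative f') (at x)"
    using assms by (auto simp: differentiable_def)
  interpret bounded_linear f' using f' by (rule has_derivative_bounded_linear)
  have "((\<lambda>t. x + t *\<^sub>R axis i 1) has_derivative (\<lambda>t. t *\<^sub>R axis i 1)) (at (0::real))"
    by (auto intro!: derivative_eq_intros)
  then have "((\<lambda>t. f (x + t *\<^sub>R axis i 1)) has_derivative (\<lambda>t. f' (t *\<^sub>R axis i 1))) (at 0)"
    by (rule has_derivative_compose) (use f' in simp)
  then show ?thesis
    by (simp add: has_field_derivative_def partial_deriv_has_derivative[OF f'] scale mult_commute_abs)
qed

text \<open>A syntactic class that contains the kernels used later as test functions and is stable
  under partial differentiation, so smoothness of every order follows from one induction. Powers
  require a positive base because \<open>powr\<close> is in general not smooth at 0.\<close>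

inductive elementary_smooth :: "(real ^ 'n::finite \<Rightarrow> real) \<Rightarrow> bool" where
  const: "elementary_smooth (\<lambda>x. c)"
| coord: "elementary_smooth (\<lambda>x. x $ i)"
| add: "elementary_smooth f \<Longrightarrow> elementary_smooth g \<Longrightarrow> elementary_smooth (\<lambda>x. f x + g x)"
| mult: "elementary_smooth f \<Longrightarrow> elementary_smooth g \<Longrightarrow> elementary_smooth (\<lambda>x. f x * g x)"
| bump: "elementary_smooth f \<Longrightarrow> elementary_smooth (\<lambda>x. bump_exp k (f x))"
| powr: "elementary_smooth f \<Longrightarrow> (\<And>x. f x > 0) \<Longrightarrow> elementary_smooth (\<lambda>x. f x powr p)"

lemma elementary_smooth_cmult: "elementary_smooth f \<Longrightarrow> elementary_smooth (\<lambda>x. c * f x)"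
  by (intro elementary_smooth.intros)

lemma elementary_smooth_diff:
  assumes "elementary_smooth f" "elementary_smooth g"
  shows "elementary_smooth (\<lambda>x. f x - g x)"
  using elementary_smooth.add[OF assms(1) elementary_smooth_cmult[OF assms(2), of "-1"]] by simp

lemma elementary_smooth_sum:
  assumes "\<And>i. i \<in> I \<Longrightarrow> elementary_smooth (f i)"
  shows "elementary_smooth (\<lambda>x. \<Sum>i\<in>I. f i x)"
  using assms
  by (induction I rule: infinite_finite_induct) (auto intro: elementary_smooth.intros)

lemma has_derivative_bump_exp:
  assumes "f differentiable (at x)"
  shows "((\<lambda>x. bump_exp k (f x)) has_derivative
    (\<lambda>h. (bump_exp (k + 2) (f x) - real k * bump_exp (k + 1) (f x)) * frechet_derivative f (at x) h)) (at x)"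
  using has_derivative_compose[OF iffD1[OF frechet_derivative_works assms]
      bump_exp_has_derivative[unfolded has_field_derivative_def]]
  by simp

text \<open>Differentiability and closure are proved in one induction because the product and chain
  rules that compute the partial derivatives presuppose differentiability of the parts. The formula
  for \<open>bump_exp k\<close> raises the index and the one for \<open>powr\<close> lowers the
  exponent, both within the class.\<close>

lemma elementary_smooth_partial_deriv:
  fixes f :: "real ^ 'n::finite \<Rightarrow> real"
  assumes "elementary_smooth f"
  shows "(\<forall>x. f differentiable (at x)) \<and> (\<forall>i. elementary_smooth (partial_deriv i f))"
  using assms
proof induction
  case (const c)
  have "partial_deriv i (\<lambda>x. c) = (\<lambda>x::real^'n. 0)" for i :: 'n
    by (rule ext) (simp add: partial_deriv_has_derivative[OF has_derivative_const])
  then show ?case by (auto intro: elementary_smooth.intros)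
next
  case (coord j)
  have "partial_deriv i (\<lambda>x. x $ j) = (\<lambda>x::real^'n. axis i 1 $ j)" for i :: 'n
    by (rule ext) (rule partial_deriv_has_derivative[where f'="\<lambda>h. h $ j"], auto intro!: derivative_eq_intros bounded_linear_imp_has_derivative)
  then show ?case by (auto intro: elementary_smooth.intros bounded_linear_imp_differentiable)
next
  case (add f g)
  then have f: "(f has_derivative frechet_derivative f (at x)) (at x)"
    and g: "(g has_derivative frechet_derivative g (at x)) (at x)" for x
    by (auto intro: frechet_derivative_works[THEN iffD1])
  have "partial_deriv i (\<lambda>x. f x + g x) = (\<lambda>x. partial_deriv i f x + partial_deriv i g x)" for i
    by (rule ext) (simp add: partial_deriv_has_derivative[OF has_derivative_add[OF f g]] partial_deriv_def)
  with add show ?case by (auto intro: elementary_smooth.intros)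
next
  case (mult f g)
  then have f: "(f has_derivative frechet_derivative f (at x)) (at x)"
    and g: "(g has_derivative frechet_derivative g (at x)) (at x)" for x
    by (auto intro: frechet_derivative_works[THEN iffD1])
  have "partial_deriv i (\<lambda>x. f x * g x) = (\<lambda>x. f x * partial_deriv i g x + partial_deriv i f x * g x)" for i
    by (rule ext) (simp add: partial_deriv_has_derivative[OF has_derivative_mult[OF f g]] partial_deriv_def)
  with mult show ?case by (auto intro!: elementary_smooth.add elementary_smooth.mult)
next
  case (bump f k)
  have "partial_deriv i (\<lambda>x. bump_exp k (f x)) =
      (\<lambda>x. (bump_exp (k + 2) (f x) - real k * bump_exp (k + 1) (f x)) * partial_deriv i f x)" for i
    using bump by (intro ext) (subst partial_deriv_has_derivative[OF has_derivative_bump_exp], auto simp: partial_deriv_def)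
  moreover have "elementary_smooth (\<lambda>x. (bump_exp (k + 2) (f x) - real k * bump_exp (k + 1) (f x)) * partial_deriv i f x)" for i
    by (intro elementary_smooth.mult elementary_smooth_diff elementary_smooth_cmult elementary_smooth.bump)
      (use bump in auto)
  moreover have "(\<lambda>x. bump_exp k (f x)) differentiable (at x)" for x
    using bump by (intro differentiableI[OF has_derivative_bump_exp]) auto
  ultimately show ?case by simp
next
  case (powr f p)
  have D: "((\<lambda>x. f x powr p) has_derivative (\<lambda>h. p * f x powr (p - 1) * frechet_derivative f (at x) h)) (at x)" for x
  proof -
    have 1: "((\<lambda>t. t powr p) has_derivative (\<lambda>h. p * f x powr (p - 1) * h)) (at (f x))"
      using has_real_derivative_powr[OF powr(2)[of x], of p] unfolding has_field_derivative_def .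
    show ?thesis
      using has_derivative_compose[OF iffD1[OF frechet_derivative_works, of f "at x"] 1] powr by auto
  qed
  have "partial_deriv i (\<lambda>x. f x powr p) = (\<lambda>x. p * (f x powr (p - 1) * partial_deriv i f x))" for i
    by (rule ext) (subst partial_deriv_has_derivative[OF D], simp add: partial_deriv_def)
  with powr show ?case
    by (auto intro!: elementary_smooth.intros elementary_smooth_cmult differentiableI[OF D])
qed

lemma elementary_smooth_imp_smooth_fun:
  assumes "elementary_smooth f"
  shows "smooth_fun f"
proof -
  have "elementary_smooth (partial_derivs \<alpha> f)" for \<alpha>
    unfolding partial_derivs_def
    by (induction \<alpha>) (use assms elementary_smooth_partial_deriv in auto)
  then show ?thesis
    unfolding smooth_fun_def
    using elementary_smooth_partial_deriv differentiable_at_imp_differentiable_on by blast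
qed

subsection \<open>Integration by parts against test functions\<close>

lemma smooth_fun_partial_derivs:
  assumes "smooth_fun \<phi>"
  shows "partial_derivs \<alpha> \<phi> differentiable (at x)" "continuous_on S (partial_derivs \<alpha> \<phi>)"
proof -
  have "partial_derivs \<alpha> \<phi> differentiable_on UNIV"
    using assms by (auto simp: smooth_fun_def)
  then show "partial_derivs \<alpha> \<phi> differentiable (at x)" "continuous_on S (partial_derivs \<alpha> \<phi>)"
    using differentiable_imp_continuous_on[of "partial_derivs \<alpha> \<phi>" UNIV] continuous_on_subset[of UNIV _ S]
    by (simp_all add: differentiable_on_def)
qed

lemma partial_derivs_eq_0:
  assumes "closed K" and "\<And>x. x \<notin> K \<Longrightarrow> \<phi> x = 0" and "x \<notin> K"
  shows "partial_derivs \<alpha> \<phi> x = 0"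
  using assms(3)
proof (induction \<alpha> arbitrary: x)
  case Nil
  then show ?case using assms(2) by (simp add: partial_derivs_def)
next
  case (Cons i \<alpha>)
  have "((\<lambda>x. 0) has_derivative (\<lambda>h. 0)) (at x)" by simp
  then have "(partial_derivs \<alpha> \<phi> has_derivative (\<lambda>h. 0)) (at x)"
    by (rule has_derivative_transform_within_open[of _ _ _ _ "- K"]) (use Cons assms(1) in auto)
  then have "partial_deriv i (partial_derivs \<alpha> \<phi>) x = 0"
    by (rule partial_deriv_has_derivative)
  then show ?case by (simp add: partial_derivs_def)
qed

section \<open>Extension by zero and integrals over the whole space\<close>

lemma continuous_on_extend_0:
  fixes f :: "'a::topological_space \<Rightarrow> 'b::{topological_space, zero}"
  assumes "open \<Omega>" "continuous_on \<Omega> f" "closed K" "K \<subseteq> \<Omega>" "\<And>x. x \<notin> K \<Longrightarrow> f x = 0"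
  shows "continuous_on UNIV f"
proof -
  have "continuous_on (- K) f"
    using assms(5) by (simp cong: continuous_on_cong_simp)
  then have "continuous_on (\<Omega> \<union> - K) f"
    using assms by (intro continuous_on_open_Un) auto
  moreover have "\<Omega> \<union> - K = UNIV" using assms(4) by auto
  ultimately show ?thesis by simp
qed

lemma integrable_lborel_compact_support:
  fixes f :: "'a::euclidean_space \<Rightarrow> real"
  assumes "continuous_on UNIV f" "compact K" "\<And>x. x \<notin> K \<Longrightarrow> f x = 0"
  shows "integrable lborel f"
proof -
  have "integrable lborel (\<lambda>x. indicator K x *\<^sub>R f x)"
    using assms by (intro borel_integrable_compact) (auto intro: continuous_on_subset)
  moreover have "(\<lambda>x. indicator K x *\<^sub>R f x) = f"
    using assms(3) by (auto simp: fun_eq_iff indicator_def)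
  ultimately show ?thesis by simp
qed

text \<open>Weak derivatives are defined by integrals on \<open>lebesgue_on \<Omega>\<close>; for
  functions vanishing off \<Omega> these pass to \<open>lborel\<close>, where translations and
  scalings can be carried out.\<close>

lemma integral_lebesgue_on_eq_lborel:
  fixes f :: "'a::euclidean_space \<Rightarrow> real"
  assumes "\<Omega> \<in> sets lebesgue" "f \<in> borel_measurable borel" "\<And>x. x \<notin> \<Omega> \<Longrightarrow> f x = 0"
  shows "integral\<^sup>L (lebesgue_on \<Omega>) f = integral\<^sup>L lborel f"
    and "integrable (lebesgue_on \<Omega>) f \<longleftrightarrow> integrable lborel f"
proof -
  have "(\<lambda>x. indicator \<Omega> x *\<^sub>R f x) = f"
    using assms(3) by (auto simp: fun_eq_iff indicator_def)
  then show "integral\<^sup>L (lebesgue_on \<Omega>) f = integral\<^sup>L lborel f"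
    and "integrable (lebesgue_on \<Omega>) f \<longleftrightarrow> integrable lborel f"
    using assms(1,2)
    by (simp_all add: integral_restrict_space integrable_restrict_space integral_completion integrable_completion)
qed

lemma integral_lborel_translation:
  fixes f :: "'a::euclidean_space \<Rightarrow> real"
  assumes "f \<in> borel_measurable borel"
  shows "(\<integral>x. f (x + c) \<partial>lborel) = (\<integral>x. f x \<partial>lborel)"
proof -
  have "(\<integral>x. f x \<partial>lborel) = (\<integral>x. f x \<partial>distr lborel borel ((+) c))"
    by (simp add: lborel_distr_plus)
  also have "\<dots> = (\<integral>x. f (c + x) \<partial>lborel)"
    using assms by (intro integral_distr) auto
  finally show ?thesis by (simp add: add.commute)
qed

text \<open>The difference quotients \<open>s n\<close> integrate to 0 by translation invariance and
  converge pointwise to \<open>f'\<close>. The mean value theorem bounds them uniformly, so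
  dominated convergence applies; no iterated integration is involved.\<close>

lemma integral_directional_derivative_eq_0:
  fixes f f' :: "'a::euclidean_space \<Rightarrow> real"
  assumes cont: "continuous_on UNIV f" "continuous_on UNIV f'"
    and K: "compact K" "\<And>x. x \<notin> K \<Longrightarrow> f x = 0" "\<And>x. x \<notin> K \<Longrightarrow> f' x = 0"
    and D: "\<And>x. ((\<lambda>t. f (x + t *\<^sub>R e)) has_real_derivative f' x) (at 0)"
  shows "integral\<^sup>L lborel f' = 0"
proof -
  have D': "((\<lambda>t. f (x + t *\<^sub>R e)) has_real_derivative f' (x + t *\<^sub>R e)) (at t)" for x t
    using D[of "x + t *\<^sub>R e"] DERIV_shift[of "\<lambda>s. f (x + s *\<^sub>R e)" "f' (x + t *\<^sub>R e)" 0 t]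
    by (simp add: algebra_simps)
  obtain B where B: "\<And>x. x \<in> K \<Longrightarrow> norm (f' x) \<le> B"
    using compact_imp_bounded[OF compact_continuous_image[OF continuous_on_subset[OF cont(2)] K(1)]]
    by (auto simp: bounded_iff)
  define B' where "B' = max B 0"
  have B': "\<bar>f' x\<bar> \<le> B'" for x
    using B[of x] K(3)[of x] by (cases "x \<in> K") (auto simp: B'_def)
  obtain R where R: "\<And>x. x \<in> K \<Longrightarrow> norm x \<le> R"
    using compact_imp_bounded[OF K(1)] by (auto simp: bounded_iff)
  define t where "t n = 1 / real (Suc n)" for n
  have t: "0 < t n" "t n \<le> 1" for n by (auto simp: t_def)
  have t0: "t \<longlonglongrightarrow> 0"
    unfolding t_def using LIMSEQ_inverse_real_of_nat by (simp add: inverse_eq_divide)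
  define s where "s n x = (f (x + t n *\<^sub>R e) - f x) / t n" for n x
  have meas: "f \<in> borel_measurable borel" "f' \<in> borel_measurable borel"
    using cont by (auto intro: borel_measurable_continuous_onI)
  have int: "integrable lborel f"
    using cont K by (intro integrable_lborel_compact_support)
  have int_t: "integrable lborel (\<lambda>x. f (x + c))" for c
  proof (rule integrable_lborel_compact_support)
    show "continuous_on UNIV (\<lambda>x. f (x + c))"
      using cont by (auto intro!: continuous_on_compose2[OF cont(1)] continuous_intros)
    show "compact ((\<lambda>x. x - c) ` K)"
      using K by (intro compact_continuous_image continuous_intros)
    show "f (x + c) = 0" if "x \<notin> (\<lambda>x. x - c) ` K" for x
      using that K(2)[of "x + c"] by (metis add_diff_cancel_right' image_eqI)
  qed
  \<comment> \<open>Since \<open>t n \<le> 1\<close>, a point outside the ball of radius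
    \<open>R + norm e\<close> is not moved into \<open>K\<close>, so all quotients vanish there and
    the dominating function has compact support.\<close>
  have "(\<lambda>n. integral\<^sup>L lborel (s n)) \<longlonglongrightarrow> integral\<^sup>L lborel f'"
  proof (rule integral_dominated_convergence[where w="\<lambda>x. indicator (cball 0 (R + norm e)) x *\<^sub>R B'"])
    show "f' \<in> borel_measurable lborel" "\<And>n. s n \<in> borel_measurable lborel"
      unfolding s_def using meas by auto
    show "integrable lborel (\<lambda>x. indicator (cball 0 (R + norm e)) x *\<^sub>R B')"
      by (intro borel_integrable_compact) auto
    show "AE x in lborel. (\<lambda>n. s n x) \<longlonglongrightarrow> f' x"
    proof (rule AE_I2)
      fix x
      have "((\<lambda>h. (f (x + h *\<^sub>R e) - f x) / h) \<longlongrightarrow> f' x) (at 0)"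
        using D[of x] by (simp add: DERIV_def)
      moreover have "filterlim t (at 0) sequentially"
        using t0 t(1) by (auto simp: filterlim_at intro!: always_eventually less_imp_neq[symmetric])
      ultimately show "(\<lambda>n. s n x) \<longlonglongrightarrow> f' x"
        unfolding s_def by (rule filterlim_compose)
    qed
    show "AE x in lborel. norm (s n x) \<le> indicator (cball 0 (R + norm e)) x *\<^sub>R B'" for n
    proof (rule AE_I2)
      fix x
      show "norm (s n x) \<le> indicator (cball 0 (R + norm e)) x *\<^sub>R B'"
      proof (cases "x \<in> cball 0 (R + norm e)")
        case True
        obtain z where "f (x + t n *\<^sub>R e) - f (x + 0 *\<^sub>R e) = (t n - 0) * f' (x + z *\<^sub>R e)"
          using MVT2[OF t(1)[of n], of "\<lambda>s. f (x + s *\<^sub>R e)" "\<lambda>s. f' (x + s *\<^sub>R e)"] D' by blast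
        with True B'[of "x + z *\<^sub>R e"] t(1)[of n] show ?thesis by (simp add: s_def)
      next
        case False
        have "norm (t n *\<^sub>R e) \<le> norm e"
          using t[of n] by (simp add: mult_left_le_one_le)
        with False have "norm (x + t n *\<^sub>R e) > R" "norm x > R"
          using norm_diff_ineq[of x "t n *\<^sub>R e"] norm_ge_zero[of e] by (auto simp del: norm_scaleR norm_ge_zero)
        then have "x + t n *\<^sub>R e \<notin> K" "x \<notin> K" using R by (auto simp: not_le[symmetric])
        with False show ?thesis by (simp add: s_def K)
      qed
    qed
  qed
  moreover have "integral\<^sup>L lborel (s n) = 0" for n
    unfolding s_def using int int_t[of "t n *\<^sub>R e"] integral_lborel_translation[OF meas(1), of "t n *\<^sub>R e"]
    by simp
  ultimately show ?thesis
    by (simp add: LIMSEQ_const_iff)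
qed

lemma test_functions_D:
  assumes "\<phi> \<in> test_functions \<Omega>"
  obtains K where "compact K" "K \<subseteq> \<Omega>" "\<And>\<alpha> x. x \<notin> K \<Longrightarrow> partial_derivs \<alpha> \<phi> x = 0"
    "\<And>x. x \<notin> K \<Longrightarrow> \<phi> x = 0"
proof
  show "compact (closure {x. \<phi> x \<noteq> 0})" "closure {x. \<phi> x \<noteq> 0} \<subseteq> \<Omega>"
    using assms by (auto simp: test_functions_def)
  show 0: "\<phi> x = 0" if "x \<notin> closure {x. \<phi> x \<noteq> 0}" for x
    using that closure_subset[of "{x. \<phi> x \<noteq> 0}"] by blast
  show "partial_derivs \<alpha> \<phi> x = 0" if "x \<notin> closure {x. \<phi> x \<noteq> 0}" for \<alpha> x
    by (rule partial_derivs_eq_0[OF closed_closure 0 that])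
qed

text \<open>Both integrations by parts are done at once: \<open>w * p1 - w1 * \<phi>\<close> has
  derivative \<open>w * p2 - w2 * \<phi>\<close> along the axis, since the mixed terms
  \<open>w1 * p1\<close> cancel, and a compactly supported derivative integrates to 0.\<close>

lemma integral_mult_second_partial_deriv:
  fixes w w1 w2 :: "real ^ 'n::finite \<Rightarrow> real"
  assumes \<Omega>: "open \<Omega>" and \<phi>: "\<phi> \<in> test_functions \<Omega>"
    and cont: "continuous_on \<Omega> w" "continuous_on \<Omega> w1" "continuous_on \<Omega> w2"
    and D1: "\<And>x. x \<in> \<Omega> \<Longrightarrow> ((\<lambda>t. w (x + t *\<^sub>R axis i 1)) has_real_derivative w1 x) (at 0)"
    and D2: "\<And>x. x \<in> \<Omega> \<Longrightarrow> ((\<lambda>t. w1 (x + t *\<^sub>R axis i 1)) has_real_derivative w2 x) (at 0)"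
  shows "(LINT x|lebesgue_on \<Omega>. w x * partial_derivs [i, i] \<phi> x) = (LINT x|lebesgue_on \<Omega>. w2 x * \<phi> x)"
proof -
  let ?d = "axis i 1 :: real ^ 'n"
  obtain K where K: "compact K" "K \<subseteq> \<Omega>" "\<And>\<alpha> x. x \<notin> K \<Longrightarrow> partial_derivs \<alpha> \<phi> x = 0"
    "\<And>x. x \<notin> K \<Longrightarrow> \<phi> x = 0"
    using test_functions_D[OF \<phi>] by metis
  have closed: "closed K" using K(1) by (rule compact_imp_closed)
  have sm: "smooth_fun \<phi>" using \<phi> by (simp add: test_functions_def)
  note pd = smooth_fun_partial_derivs[OF sm]
  have \<phi>c: "continuous_on S \<phi>" for S
    using pd(2)[of S "[]"] by (simp add: partial_derivs_def)
  have ext: "continuous_on UNIV (\<lambda>x. g x * p x)"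
    if "continuous_on \<Omega> g" "continuous_on \<Omega> p" "\<And>x. x \<notin> K \<Longrightarrow> p x = 0" for g p :: "real ^ 'n \<Rightarrow> real"
    by (rule continuous_on_extend_0[OF \<Omega> _ closed K(2)]) (use that in \<open>auto intro: continuous_intros\<close>)
  define p1 p2 where "p1 = partial_derivs [i] \<phi>" and "p2 = partial_derivs [i, i] \<phi>"
  have P1: "((\<lambda>t. \<phi> (x + t *\<^sub>R ?d)) has_real_derivative p1 x) (at 0)" for x
    using has_real_derivative_along_axis[OF pd(1)[of "[]" x]] by (simp add: partial_derivs_def p1_def)
  have P2: "((\<lambda>t. p1 (x + t *\<^sub>R ?d)) has_real_derivative p2 x) (at 0)" for x
    using has_real_derivative_along_axis[OF pd(1)[of "[i]" x]] by (simp add: partial_derivs_def p1_def p2_def)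
  have p0: "p1 x = 0" "p2 x = 0" if "x \<notin> K" for x
    using that K(3) by (auto simp: p1_def p2_def)
  have pc: "continuous_on S p1" "continuous_on S p2" for S
    using pd(2) by (auto simp: p1_def p2_def)
  define f where "f x = w x * p1 x - w1 x * \<phi> x" for x
  define f' where "f' x = w x * p2 x - w2 x * \<phi> x" for x
  have c: "continuous_on UNIV (\<lambda>x. w x * p1 x)" "continuous_on UNIV (\<lambda>x. w1 x * \<phi> x)"
    "continuous_on UNIV (\<lambda>x. w x * p2 x)" "continuous_on UNIV (\<lambda>x. w2 x * \<phi> x)"
    using cont pc \<phi>c p0 K(4) by (intro ext; simp)+
  have fc: "continuous_on UNIV f" "continuous_on UNIV f'"
    unfolding f_def f'_def using c by (auto intro: continuous_on_diff)
  have f0: "f x = 0" if "x \<notin> K" for x using that K(4) p0 by (simp add: f_def)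
  have f0': "f' x = 0" if "x \<notin> K" for x using that K(4) p0 by (simp add: f'_def)
  have fD: "((\<lambda>t. f (x + t *\<^sub>R ?d)) has_real_derivative f' x) (at 0)" for x
  proof (cases "x \<in> \<Omega>")
    case True
    then have "((\<lambda>t. f (x + t *\<^sub>R ?d)) has_real_derivative
        (w1 x * p1 (x + 0 *\<^sub>R ?d) + p2 x * w (x + 0 *\<^sub>R ?d))
        - (w2 x * \<phi> (x + 0 *\<^sub>R ?d) + p1 x * w1 (x + 0 *\<^sub>R ?d))) (at 0)"
      unfolding f_def by (intro DERIV_diff DERIV_mult D1 D2 P1 P2)
    then show ?thesis by (simp add: f'_def algebra_simps)
  next
    case False
    \<comment> \<open>Off \<Omega> nothing is known about \<open>w\<close>, but \<open>f\<close>
      vanishes on the open set \<open>- K\<close>, which contains \<open>x\<close>.\<close>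
    have "((\<lambda>t::real. 0) has_real_derivative 0) (at 0)" by simp
    then have "((\<lambda>t. f (x + t *\<^sub>R ?d)) has_real_derivative 0) (at 0)"
    proof (rule has_field_derivative_transform_within_open[of _ _ _ "(\<lambda>t. x + t *\<^sub>R ?d) -` (- K)"])
      show "open ((\<lambda>t. x + t *\<^sub>R ?d) -` (- K))"
        using closed by (intro open_vimage) (auto intro!: continuous_intros)
    qed (use False K f0 in auto)
    moreover have "x \<notin> K" using False K(2) by auto
    ultimately show ?thesis using K(4) p0 by (simp add: f'_def)
  qed
  have "integral\<^sup>L lborel f' = 0"
    by (rule integral_directional_derivative_eq_0[OF fc K(1) f0 f0' fD])
  moreover have "integral\<^sup>L lborel f' = (\<integral>x. w x * p2 x \<partial>lborel) - (\<integral>x. w2 x * \<phi> x \<partial>lborel)"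
    unfolding f'_def using c K p0
    by (intro Bochner_Integration.integral_diff integrable_lborel_compact_support[where K=K]) auto
  moreover have m: "(\<lambda>x. w x * p2 x) \<in> borel_measurable borel" "(\<lambda>x. w2 x * \<phi> x) \<in> borel_measurable borel"
    by (rule borel_measurable_continuous_onI[OF c(3)] borel_measurable_continuous_onI[OF c(4)])+
  have \<Omega>_meas: "\<Omega> \<in> sets lebesgue"
    using \<Omega> by simp
  have p\<Omega>: "p2 x = 0" "\<phi> x = 0" if "x \<notin> \<Omega>" for x
    using subsetD[OF K(2), of x] K(4)[of x] p0(2)[of x] that by argo+
  moreover have "(LINT x|lebesgue_on \<Omega>. w x * p2 x) = (\<integral>x. w x * p2 x \<partial>lborel)"
    by (rule integral_lebesgue_on_eq_lborel(1)[OF \<Omega>_meas m(1)]) (simp add: p\<Omega>)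
  moreover have "(LINT x|lebesgue_on \<Omega>. w2 x * \<phi> x) = (\<integral>x. w2 x * \<phi> x \<partial>lborel)"
    by (rule integral_lebesgue_on_eq_lborel(1)[OF \<Omega>_meas m(2)]) (simp add: p\<Omega>)
  ultimately show ?thesis by (simp add: p2_def)
qed

subsection \<open>A concentrating kernel\<close>

lemma between_powers_of_2:
  fixes x :: real
  assumes "1 < x"
  obtains k where "2 ^ k < x" "x \<le> 2 ^ Suc k"
proof -
  obtain n where n: "x < 2 ^ n" using real_arch_pow[of 2 x] by auto
  also have "(2::real) ^ n \<le> 2 ^ Suc n" by simp
  finally have ex: "x \<le> 2 ^ Suc n" by simp
  define k where "k = (LEAST n. x \<le> 2 ^ Suc n)"
  have 1: "x \<le> 2 ^ Suc k" unfolding k_def by (rule LeastI[of "\<lambda>n. x \<le> 2 ^ Suc n", OF ex])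
  have 2: "2 ^ k < x"
  proof (cases k)
    case 0
    with assms show ?thesis by simp
  next
    case (Suc j)
    then have "\<not> x \<le> 2 ^ Suc j"
      using not_less_Least[of j "\<lambda>n. x \<le> 2 ^ Suc n"] by (simp add: k_def)
    with Suc show ?thesis by simp
  qed
  show thesis using that[OF 2 1] .
qed

text \<open>Dyadic shells: for \<open>2 ^ k < norm y\<close> the integrand is at most
  \<open>(1 / 2) ^ (k * (N + 2))\<close>, while the ball of radius \<open>2 ^ Suc k\<close> has
  volume proportional to \<open>2 ^ (k * N)\<close>, so the products form a geometric series of
  ratio \<open>1 / 4\<close>. The unit ball is assigned to index 0.\<close>

lemma integrable_one_plus_norm_powr:
  "integrable lborel (\<lambda>y::'a::euclidean_space. (1 + (norm y)\<^sup>2) powr - (real DIM('a) / 2 + 1))"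
proof -
  let ?N = "DIM('a)"
  let ?f = "\<lambda>y::'a. (1 + (norm y)\<^sup>2) powr - (real ?N / 2 + 1)"
  let ?c = "\<lambda>k::nat. (1 / 2 :: real) ^ (k * (?N + 2))"
  have shell: "\<exists>k. ?f y \<le> ?c k \<and> norm y \<le> 2 ^ Suc k" for y :: 'a
  proof (cases "norm y \<le> 1")
    case True
    have "?f y \<le> 1 powr - (real ?N / 2 + 1)"
      by (rule powr_mono2') auto
    with True show ?thesis by (intro exI[of _ 0]) auto
  next
    case False
    then obtain k where k: "2 ^ k < norm y" "norm y \<le> 2 ^ Suc k"
      using between_powers_of_2[of "norm y"] by auto
    have "?f y \<le> ((2 ^ k)\<^sup>2) powr - (real ?N / 2 + 1)"
    proof (rule powr_mono2')
      have "(2 ^ k)\<^sup>2 \<le> (norm y)\<^sup>2"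
        using k(1) by (intro power_mono) auto
      then show "(2 ^ k)\<^sup>2 \<le> 1 + (norm y)\<^sup>2" by linarith
    qed auto
    also have "\<dots> = (2 powr real (2 * k)) powr - (real ?N / 2 + 1)"
      by (subst powr_realpow) (auto simp: power_mult[symmetric] mult.commute)
    also have "\<dots> = 2 powr - real (k * (?N + 2))"
      by (subst powr_powr, rule arg_cong[where f="\<lambda>x. 2 powr x"]) (simp add: field_simps)
    also have "\<dots> = ?c k"
      by (subst powr_minus, subst powr_realpow) (auto simp: power_one_over divide_simps)
    finally show ?thesis using k by auto
  qed
  have "(\<integral>\<^sup>+y. ennreal (?f y) \<partial>lborel) \<le> (\<integral>\<^sup>+y. (\<Sum>k. ennreal (?c k) * indicator (cball (0::'a) (2 ^ Suc k)) y) \<partial>lborel)"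
  proof (rule nn_integral_mono)
    fix y :: 'a
    obtain k where k: "?f y \<le> ?c k" "norm y \<le> 2 ^ Suc k" using shell by blast
    let ?g = "\<lambda>k. ennreal (?c k) * indicator (cball (0::'a) (2 ^ Suc k)) y"
    have "ennreal (?f y) \<le> ?g k" using k by (simp add: ennreal_leI)
    also have "?g k = sum ?g {k}" by (simp only: sum.insert finite.emptyI empty_iff sum.empty add_0_right if_False not_False_eq_True)
    also have "\<dots> \<le> (\<Sum>k. ?g k)"
      by (rule sum_le_suminf) auto
    finally show "ennreal (?f y) \<le> (\<Sum>k. ?g k)" .
  qed
  also have "\<dots> = (\<Sum>k. \<integral>\<^sup>+y. ennreal (?c k) * indicator (cball (0::'a) (2 ^ Suc k)) y \<partial>lborel)"
    by (rule nn_integral_suminf) (intro borel_measurable_times_ennreal borel_measurable_const borel_measurable_indicator, simp)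
  also have "\<dots> = (\<Sum>k. ennreal (unit_ball_vol ?N * 2 ^ ?N * (1 / 4) ^ k))"
  proof (rule suminf_cong)
    fix k :: nat
    have "(\<integral>\<^sup>+y. ennreal (?c k) * indicator (cball (0::'a) (2 ^ Suc k)) y \<partial>lborel)
        = ennreal (?c k) * emeasure lborel (cball (0::'a) (2 ^ Suc k))"
      by (rule nn_integral_cmult_indicator) auto
    also have "\<dots> = ennreal (?c k * (unit_ball_vol ?N * (2 ^ Suc k) ^ ?N))"
      by (subst emeasure_cball) (auto simp: ennreal_mult)
    also have "?c k * (unit_ball_vol ?N * (2 ^ Suc k) ^ ?N) = unit_ball_vol ?N * 2 ^ ?N * (1 / 4) ^ k"
    proof -
      have "?c k * (2 ^ k) ^ ?N = (1 / 2 :: real) ^ (k * 2) * ((1 / 2) ^ (k * ?N) * 2 ^ (k * ?N))"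
        by (simp only: add_mult_distrib2 power_add power_mult mult_ac)
      also have "\<dots> = (1 / 4) ^ k"
        by (simp only: power_mult_distrib[symmetric] mult.commute[of k 2] power_mult) (simp add: power2_eq_square)
      finally show ?thesis by (simp add: power_mult_distrib mult_ac)
    qed
    finally show "(\<integral>\<^sup>+y. ennreal (?c k) * indicator (cball (0::'a) (2 ^ Suc k)) y \<partial>lborel)
        = ennreal (unit_ball_vol ?N * 2 ^ ?N * (1 / 4) ^ k)" .
  qed
  also have "\<dots> = ennreal (\<Sum>k. unit_ball_vol ?N * 2 ^ ?N * (1 / 4) ^ k)"
    by (rule suminf_ennreal2) (auto intro!: summable_mult summable_geometric)
  also have "\<dots> < \<infinity>" by simp
  finally show ?thesis
    by (intro integrableI_nonneg) auto
qed

lemma lborel_integral_affine: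
  fixes f :: "'a::euclidean_space \<Rightarrow> real"
  assumes "f \<in> borel_measurable borel" "c \<noteq> 0"
  shows "(\<integral>x. f x \<partial>lborel) = \<bar>c\<bar> ^ DIM('a) * (\<integral>x. f (t + c *\<^sub>R x) \<partial>lborel)"
  using assms
  by (subst lborel_affine[of c t]) (simp_all add: integral_density integral_distr)

text \<open>The substitution \<open>x = x0 + t y\<close> turns the kernel into a fixed integrable
  profile: the factor \<open>t ^ N\<close> from the volume, the explicit \<open>t ^ 2\<close> and
  the \<open>t\<close> to the power \<open>- N - 2\<close> from the scaled base cancel. Dominated
  convergence then uses that \<open>g (x0 + t y)\<close> tends to \<open>g x0 = 0\<close>.\<close>

lemma integral_concentrating_kernel_tendsto_0:
  fixes g :: "'a::euclidean_space \<Rightarrow> real" and t :: "nat \<Rightarrow> real"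
  assumes g: "g \<in> borel_measurable borel" "\<And>x. \<bar>g x\<bar> \<le> M" "isCont g x0" "g x0 = 0"
    and t: "\<And>n. t n > 0" "t \<longlonglongrightarrow> 0"
  shows "(\<lambda>n. \<integral>x. g x * ((t n)\<^sup>2 * ((norm (x - x0))\<^sup>2 + (t n)\<^sup>2) powr - (real DIM('a) / 2 + 1)) \<partial>lborel) \<longlonglongrightarrow> 0"
proof -
  let ?N = "DIM('a)"
  let ?p = "real ?N / 2 + 1"
  let ?f = "\<lambda>y::'a. (1 + (norm y)\<^sup>2) powr - ?p"
  note [measurable] = g(1)
  have eq: "(\<integral>x. g x * ((t n)\<^sup>2 * ((norm (x - x0))\<^sup>2 + (t n)\<^sup>2) powr - ?p) \<partial>lborel)
      = (\<integral>y. g (x0 + t n *\<^sub>R y) * ?f y \<partial>lborel)" for n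
  proof -
    have t2: "((t n)\<^sup>2) powr - ?p = inverse ((t n) ^ (?N + 2))"
    proof -
      have "((t n)\<^sup>2) powr - ?p = t n powr - real (?N + 2)"
        using t(1)[of n]
        by (subst powr_numeral[symmetric], simp, subst powr_powr, intro arg_cong[where f="\<lambda>x. t n powr x"])
          (simp add: field_simps)
      then show ?thesis using t(1)[of n] by (simp only: powr_minus powr_realpow)
    qed
    let ?h = "\<lambda>x. g x * ((t n)\<^sup>2 * ((norm (x - x0))\<^sup>2 + (t n)\<^sup>2) powr - ?p)"
    have h: "t n ^ ?N * ?h (x0 + t n *\<^sub>R y) = g (x0 + t n *\<^sub>R y) * ?f y" for y
    proof -
      have "(norm (x0 + t n *\<^sub>R y - x0))\<^sup>2 + (t n)\<^sup>2 = (t n)\<^sup>2 * (1 + (norm y)\<^sup>2)"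
        by (simp add: power_mult_distrib algebra_simps)
      then have "((norm (x0 + t n *\<^sub>R y - x0))\<^sup>2 + (t n)\<^sup>2) powr - ?p = inverse ((t n) ^ (?N + 2)) * ?f y"
        by (simp only: powr_mult t2)
      then have "t n ^ ?N * ?h (x0 + t n *\<^sub>R y)
          = (t n ^ ?N * (t n)\<^sup>2 * inverse (t n ^ (?N + 2))) * (g (x0 + t n *\<^sub>R y) * ?f y)"
        by (simp only: mult_ac)
      also have "t n ^ ?N * (t n)\<^sup>2 * inverse (t n ^ (?N + 2)) = 1"
        using t(1)[of n] by (simp add: power_add power2_eq_square field_simps)
      finally show ?thesis by simp
    qed
    have "(\<integral>x. ?h x \<partial>lborel) = \<bar>t n\<bar> ^ ?N * (\<integral>y. ?h (x0 + t n *\<^sub>R y) \<partial>lborel)"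
      using t(1)[of n] by (intro lborel_integral_affine) auto
    also have "\<dots> = (\<integral>y. t n ^ ?N * ?h (x0 + t n *\<^sub>R y) \<partial>lborel)"
      using t(1)[of n] by (subst integral_mult_right_zero) simp
    finally show ?thesis by (simp only: h)
  qed
  have "(\<lambda>n. \<integral>y. g (x0 + t n *\<^sub>R y) * ?f y \<partial>lborel) \<longlonglongrightarrow> (\<integral>y. 0 \<partial>(lborel::'a measure))"
  proof (rule integral_dominated_convergence[where w="\<lambda>y. M * ?f y"])
    show "integrable lborel (\<lambda>y. M * ?f y)"
      using integrable_one_plus_norm_powr by (rule integrable_mult_right)
    show "AE y in lborel. (\<lambda>n. g (x0 + t n *\<^sub>R y) * ?f y) \<longlonglongrightarrow> 0"
    proof (rule AE_I2)
      fix y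
      have "(\<lambda>n. x0 + t n *\<^sub>R y) \<longlonglongrightarrow> x0 + 0 *\<^sub>R y" by (intro tendsto_intros t)
      then have "(\<lambda>n. g (x0 + t n *\<^sub>R y)) \<longlonglongrightarrow> 0"
        using isCont_tendsto_compose[OF g(3), of "\<lambda>n. x0 + t n *\<^sub>R y" sequentially] g(4) by simp
      then show "(\<lambda>n. g (x0 + t n *\<^sub>R y) * ?f y) \<longlonglongrightarrow> 0"
        by (rule tendsto_mult_left_zero)
    qed
    show "AE y in lborel. norm (g (x0 + t n *\<^sub>R y) * ?f y) \<le> M * ?f y" for n
    proof (rule AE_I2)
      fix y
      have "\<bar>g (x0 + t n *\<^sub>R y)\<bar> * ?f y \<le> M * ?f y"
        by (rule mult_right_mono[OF g(2) powr_ge_zero])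
      then show "norm (g (x0 + t n *\<^sub>R y) * ?f y) \<le> M * ?f y"
        by (simp add: abs_mult)
    qed
  qed measurable
  then show ?thesis by (simp only: eq Bochner_Integration.integral_zero)
qed

subsection \<open>Truncated fundamental solutions\<close>

text \<open>The ramp is convex with slope in \<open>[0, 1]\<close>; truncating a superharmonic function with it
  therefore never makes the Laplacian more negative.\<close>

definition ramp :: "real \<Rightarrow> real" where
  "ramp t = t * bump_exp 0 t"

definition ramp' :: "real \<Rightarrow> real" where
  "ramp' t = bump_exp 0 t + bump_exp 1 t"

lemma ramp_has_derivative: "(ramp has_real_derivative ramp' t) (at t)"
proof -
  have "t * bump_exp 2 t = bump_exp 1 t"
    by (simp add: bump_exp_def power2_eq_square)
  then show ?thesis
    unfolding ramp_def[abs_def] ramp'_def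
    using DERIV_mult[OF DERIV_ident bump_exp_has_derivative[of 0 t]] by (simp add: mult.commute numeral_2_eq_2)
qed

text \<open>The \<open>bump_exp 2\<close> terms cancel and leave a nonnegative function; this is the
  convexity of the ramp.\<close>

lemma ramp'_has_derivative: "(ramp' has_real_derivative bump_exp 3 t) (at t)"
  unfolding ramp'_def[abs_def]
  using DERIV_add[OF bump_exp_has_derivative[of 0 t] bump_exp_has_derivative[of 1 t]]
  by (simp add: numeral_2_eq_2 numeral_3_eq_3)

lemma ramp_nonneg: "0 \<le> ramp t"
  by (simp add: ramp_def bump_exp_def)

lemma ramp_eq_0: "t \<le> 0 \<Longrightarrow> ramp t = 0"
  by (simp add: ramp_def bump_exp_def)

lemma ramp_pos: "0 < t \<Longrightarrow> 0 < ramp t"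
  by (simp add: ramp_def bump_exp_def)

lemma ramp'_nonneg: "0 \<le> ramp' t"
  by (simp add: ramp'_def bump_exp_nonneg)

text \<open>With \<open>s = 1 / t\<close> this is \<open>1 + s \<le> exp s\<close>.\<close>

lemma ramp'_le_1: "ramp' t \<le> 1"
proof (cases "t > 0")
  case True
  have "(1 + 1 / t) * exp (- (1 / t)) \<le> exp (1 / t) * exp (- (1 / t))"
    by (intro mult_right_mono exp_ge_add_one_self) simp
  also have "\<dots> = 1" by (simp flip: exp_add)
  finally show ?thesis using True by (simp add: ramp'_def bump_exp_def algebra_simps)
qed (simp add: ramp'_def bump_exp_def)

lemma ramp_mono: "s \<le> t \<Longrightarrow> ramp s \<le> ramp t"
  using DERIV_nonneg_imp_nondecreasing[of s t ramp] ramp_has_derivative ramp'_nonneg by blast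

text \<open>Taking the squared distance as radial variable keeps everything differentiable at
  \<open>x0\<close>. The coordinate \<open>i\<close> contributes
  \<open>2 F' + 4 (x_i - x0_i)^2 F''\<close>.\<close>

lemma sum_partial_derivs_radial:
  fixes x0 :: "real ^ 'n::finite" and F F' F'' :: "real \<Rightarrow> real"
  assumes F: "\<And>t. 0 \<le> t \<Longrightarrow> (F has_real_derivative F' t) (at t)"
    "\<And>t. 0 \<le> t \<Longrightarrow> (F' has_real_derivative F'' t) (at t)"
  defines "q \<equiv> \<lambda>x. (norm (x - x0))\<^sup>2"
  shows "(\<Sum>i\<in>UNIV. partial_derivs [i, i] (\<lambda>x. F (q x)) x)
    = 2 * real CARD('n) * F' (q x) + 4 * q x * F'' (q x)"
proof -
  have q: "(q has_derivative (\<lambda>h. 2 * ((x - x0) \<bullet> h))) (at x)" for x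
    unfolding q_def power2_norm_eq_inner
    by (auto intro!: derivative_eq_intros simp: inner_commute algebra_simps)
  have q0: "0 \<le> q x" for x by (simp add: q_def)
  have D: "((\<lambda>x. F (q x)) has_derivative (\<lambda>h. F' (q x) * (2 * ((x - x0) \<bullet> h)))) (at x)" for x
    using has_derivative_compose[OF q F(1)[OF q0, unfolded has_field_derivative_def]] .
  have D': "((\<lambda>x. F' (q x)) has_derivative (\<lambda>h. F'' (q x) * (2 * ((x - x0) \<bullet> h)))) (at x)" for x
    using has_derivative_compose[OF q F(2)[OF q0, unfolded has_field_derivative_def]] .
  have P: "partial_deriv i (\<lambda>x. F (q x)) = (\<lambda>x. F' (q x) * (2 * (x - x0) $ i))" for i
    by (rule ext, subst partial_deriv_has_derivative[OF D]) (simp add: inner_axis)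
  have C: "((\<lambda>x. 2 * (x - x0) $ i) has_derivative (\<lambda>h. 2 * h $ i)) (at x)" for i x
    by (auto intro!: derivative_eq_intros bounded_linear_imp_has_derivative)
  have "partial_derivs [i, i] (\<lambda>x. F (q x)) x = 2 * F' (q x) + 4 * ((x - x0) $ i)\<^sup>2 * F'' (q x)" for i
    unfolding partial_derivs_def foldr.simps o_def P id_def
    by (subst partial_deriv_has_derivative[OF has_derivative_mult[OF D' C]])
      (simp add: inner_axis power2_eq_square algebra_simps)
  then have "(\<Sum>i\<in>UNIV. partial_derivs [i, i] (\<lambda>x. F (q x)) x)
      = real CARD('n) * (2 * F' (q x)) + 4 * (\<Sum>i\<in>UNIV. ((x - x0) $ i)\<^sup>2) * F'' (q x)"
    by (simp add: sum.distrib sum_distrib_left sum_distrib_right mult.assoc)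
  moreover have "(\<Sum>i\<in>UNIV. ((x - x0) $ i)\<^sup>2) = q x"
    by (simp add: q_def norm_vec_def L2_set_def sum_nonneg)
  ultimately show ?thesis by simp
qed

text \<open>The exponent \<open>1 - N/2\<close> is applied to \<open>|x - x\<^sub>0|\<^sup>2 + \<delta>\<close>: for \<open>\<delta> = 0\<close> this is the fundamental
  solution \<open>|x - x\<^sub>0| powr (2 - N)\<close> up to a constant factor.\<close>

definition trunc_kernel :: "real ^ 'n::finite \<Rightarrow> real \<Rightarrow> real \<Rightarrow> real ^ 'n \<Rightarrow> real" where
  "trunc_kernel x0 \<rho> \<delta> x =
     ramp (((norm (x - x0))\<^sup>2 + \<delta>) powr (1 - real CARD('n) / 2) - (\<rho>\<^sup>2) powr (1 - real CARD('n) / 2))"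

lemma trunc_kernel_nonneg: "0 \<le> trunc_kernel x0 \<rho> \<delta> x"
  by (simp add: trunc_kernel_def ramp_nonneg)

lemma trunc_kernel_eq_0:
  fixes x0 :: "real ^ 'n::finite"
  assumes "CARD('n) \<ge> 3" "0 < \<rho>" "0 < \<delta>" "x \<notin> cball x0 \<rho>"
  shows "trunc_kernel x0 \<rho> \<delta> x = 0"
proof -
  have "\<rho>\<^sup>2 \<le> (norm (x - x0))\<^sup>2"
    using assms by (intro power_mono) (auto simp: dist_norm norm_minus_commute)
  then have "\<rho>\<^sup>2 \<le> (norm (x - x0))\<^sup>2 + \<delta>" using assms by linarith
  then have "((norm (x - x0))\<^sup>2 + \<delta>) powr (1 - real CARD('n) / 2) \<le> (\<rho>\<^sup>2) powr (1 - real CARD('n) / 2)"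
    using assms by (intro powr_mono2') auto
  then show ?thesis by (simp add: trunc_kernel_def ramp_eq_0)
qed

lemma trunc_kernel_in_test_functions:
  fixes x0 :: "real ^ 'n::finite"
  assumes "CARD('n) \<ge> 3" "0 < \<rho>" "0 < \<delta>" "cball x0 \<rho> \<subseteq> \<Omega>"
  shows "trunc_kernel x0 \<rho> \<delta> \<in> test_functions \<Omega>"
proof -
  let ?G = "\<lambda>x. ((norm (x - x0))\<^sup>2 + \<delta>) powr (1 - real CARD('n) / 2) - (\<rho>\<^sup>2) powr (1 - real CARD('n) / 2)"
  \<comment> \<open>The squared distance is written as a polynomial in the coordinates to fit the
    inductive class; adding \<delta> makes the base of the power positive.\<close>
  have "elementary_smooth (\<lambda>x. (\<Sum>i\<in>UNIV. (x $ i - x0 $ i) * (x $ i - x0 $ i)) + \<delta>)"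
    by (intro elementary_smooth_sum elementary_smooth.add elementary_smooth.mult elementary_smooth_diff
        elementary_smooth.coord elementary_smooth.const)
  also have "(\<lambda>x. (\<Sum>i\<in>UNIV. (x $ i - x0 $ i) * (x $ i - x0 $ i)) + \<delta>) = (\<lambda>x. (norm (x - x0))\<^sup>2 + \<delta>)"
    by (simp add: fun_eq_iff norm_vec_def L2_set_def sum_nonneg power2_eq_square)
  finally have "elementary_smooth ?G"
    using assms(3) by (intro elementary_smooth_diff elementary_smooth.const elementary_smooth.powr)
      (auto intro: add_nonneg_pos)
  then have "elementary_smooth (\<lambda>x. ?G x * bump_exp 0 (?G x))"
    by (intro elementary_smooth.mult elementary_smooth.bump)
  then have "smooth_fun (trunc_kernel x0 \<rho> \<delta>)"
    by (intro elementary_smooth_imp_smooth_fun) (simp add: trunc_kernel_def[abs_def] ramp_def)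
  moreover have sub: "closure {x. trunc_kernel x0 \<rho> \<delta> x \<noteq> 0} \<subseteq> cball x0 \<rho>"
    using trunc_kernel_eq_0[OF assms(1-3), of _ x0] by (intro closure_minimal) (blast, simp)
  moreover have "compact (closure {x. trunc_kernel x0 \<rho> \<delta> x \<noteq> 0})"
    using compact_Int_closed[OF compact_cball closed_closure] sub by (metis inf.absorb2)
  ultimately show ?thesis
    using assms(4) by (simp add: test_functions_def)
qed

text \<open>Without the ramp, the Laplacian is exactly minus the right-hand side. Composing with the
  ramp multiplies it by \<open>ramp'\<close>, which lies between 0 and 1, and adds a nonnegative
  term from the convexity, so it does not become more negative.\<close>

lemma trunc_kernel_laplacian_ge:
  fixes x0 :: "real ^ 'n::finite"
  assumes "CARD('n) \<ge> 3" "0 < \<delta>"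
  shows "- (\<Sum>i\<in>UNIV. partial_derivs [i, i] (trunc_kernel x0 \<rho> \<delta>) x)
    \<le> real CARD('n) * (real CARD('n) - 2) * (\<delta> * ((norm (x - x0))\<^sup>2 + \<delta>) powr - (real CARD('n) / 2 + 1))"
proof -
  define N where "N = real CARD('n)"
  define p where "p = 1 - N / 2"
  define c where "c = (\<rho>\<^sup>2) powr p"
  define G where "G t = (t + \<delta>) powr p - c" for t
  define G' where "G' t = p * (t + \<delta>) powr (p - 1)" for t
  define G'' where "G'' t = p * ((p - 1) * (t + \<delta>) powr (p - 2))" for t
  have N: "N \<ge> 3" using assms by (simp add: N_def)
  have G: "(G has_real_derivative G' t) (at t)" if "0 \<le> t" for t
    unfolding G_def[abs_def] G'_def using that assms by (auto intro!: derivative_eq_intros)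
  have G': "(G' has_real_derivative G'' t) (at t)" if "0 \<le> t" for t
    unfolding G'_def[abs_def] G''_def using that assms by (auto intro!: derivative_eq_intros)
  have "((\<lambda>t. ramp (G t)) has_real_derivative ramp' (G t) * G' t) (at t)" if "0 \<le> t" for t
    by (rule DERIV_chain2[OF ramp_has_derivative G[OF that]])
  moreover have "((\<lambda>t. ramp' (G t) * G' t) has_real_derivative
      (bump_exp 3 (G t) * G' t) * G' t + G'' t * ramp' (G t)) (at t)" if "0 \<le> t" for t
    by (rule DERIV_mult[OF DERIV_chain2[OF ramp'_has_derivative G[OF that]] G'[OF that]])
  ultimately have L: "(\<Sum>i\<in>UNIV. partial_derivs [i, i] (\<lambda>x. ramp (G ((norm (x - x0))\<^sup>2))) x)
    = 2 * real CARD('n) * (ramp' (G ((norm (x - x0))\<^sup>2)) * G' ((norm (x - x0))\<^sup>2)) +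
      4 * (norm (x - x0))\<^sup>2 * ((bump_exp 3 (G ((norm (x - x0))\<^sup>2)) * G' ((norm (x - x0))\<^sup>2)) * G' ((norm (x - x0))\<^sup>2)
        + G'' ((norm (x - x0))\<^sup>2) * ramp' (G ((norm (x - x0))\<^sup>2)))"
    by (rule sum_partial_derivs_radial)
  define t where "t = (norm (x - x0))\<^sup>2"
  have t: "t \<ge> 0" by (simp add: t_def)
  let ?B = "N * (N - 2) * (\<delta> * (t + \<delta>) powr - (N / 2 + 1))"
  have fold: "(\<lambda>x. ramp (G ((norm (x - x0))\<^sup>2))) = trunc_kernel x0 \<rho> \<delta>"
    by (simp add: fun_eq_iff trunc_kernel_def G_def c_def p_def N_def)
  \<comment> \<open>As \<open>p - 1 = - N / 2\<close>, the sum
    \<open>2 N (t + \<delta>) + 4 t (p - 1)\<close> collapses to \<open>2 N \<delta>\<close>; this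
    factor \<delta> is what makes the bound concentrate at \<open>x0\<close>.\<close>
  have "2 * N * G' t + 4 * t * G'' t = - ?B"
  proof -
    have "(t + \<delta>) powr (p - 1) = (t + \<delta>) * (t + \<delta>) powr (p - 2)"
      using t assms(2) powr_add[of "t + \<delta>" 1 "p - 2"] by simp
    moreover have "p - 2 = - (N / 2 + 1)" by (simp add: p_def)
    ultimately show ?thesis
      unfolding G'_def G''_def by (simp only:) (simp add: p_def field_simps)
  qed
  moreover have "(\<Sum>i\<in>UNIV. partial_derivs [i, i] (trunc_kernel x0 \<rho> \<delta>) x)
      = ramp' (G t) * (2 * N * G' t + 4 * t * G'' t) + 4 * t * (bump_exp 3 (G t) * (G' t)\<^sup>2)"
    using L unfolding fold t_def[symmetric] N_def[symmetric]
    by (simp add: algebra_simps power2_eq_square)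
  ultimately have "(\<Sum>i\<in>UNIV. partial_derivs [i, i] (trunc_kernel x0 \<rho> \<delta>) x)
      = - (ramp' (G t) * ?B) + 4 * t * (bump_exp 3 (G t) * (G' t)\<^sup>2)"
    by simp
  moreover have "0 \<le> 4 * t * (bump_exp 3 (G t) * (G' t)\<^sup>2)"
    using t bump_exp_nonneg by (intro mult_nonneg_nonneg) auto
  moreover have "ramp' (G t) * ?B \<le> 1 * ?B"
    using N assms(2) by (intro mult_right_mono ramp'_le_1) auto
  ultimately show ?thesis unfolding N_def[symmetric] t_def[symmetric] by linarith
qed

text \<open>The bound does not depend on \<delta>, so the integrals of the kernels do not shrink as
  \<delta> tends to 0. The condition on \<delta> gives
  \<open>|x - x0|^2 + \<delta> \<le> \<rho>^2 / 4 + \<rho>^2 / 4\<close> on the half ball.\<close>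

lemma trunc_kernel_ge:
  fixes x0 :: "real ^ 'n::finite"
  assumes "CARD('n) \<ge> 3" "0 < \<rho>" "0 < \<delta>" "\<delta> \<le> \<rho>\<^sup>2 / 4" "x \<in> cball x0 (\<rho> / 2)"
  shows "ramp ((\<rho>\<^sup>2 / 2) powr (1 - real CARD('n) / 2) - (\<rho>\<^sup>2) powr (1 - real CARD('n) / 2)) \<le> trunc_kernel x0 \<rho> \<delta> x"
proof -
  have "(norm (x - x0))\<^sup>2 \<le> (\<rho> / 2)\<^sup>2"
    using assms by (intro power_mono) (auto simp: dist_norm norm_minus_commute)
  then have "(norm (x - x0))\<^sup>2 + \<delta> \<le> \<rho>\<^sup>2 / 2"
    using assms(4) by (simp add: power_divide)
  then have "(\<rho>\<^sup>2 / 2) powr (1 - real CARD('n) / 2) \<le> ((norm (x - x0))\<^sup>2 + \<delta>) powr (1 - real CARD('n) / 2)"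
    using assms by (intro powr_mono2') (auto intro: add_nonneg_pos)
  then show ?thesis unfolding trunc_kernel_def by (intro ramp_mono) simp
qed

subsection \<open>Strict maximum principle in the sense of distributions\<close>

text \<open>The hypothesis \<open>sub\<close> is \<open>\<Delta>v \<ge> c\<close> on the ball in the
  sense of distributions. For the truncated kernels its left side stays above a positive constant,
  while its right side is at most a multiple of the integral of \<open>- v\<close> over the ball
  against a kernel concentrating at \<open>x0\<close>, and this tends to 0 because
  \<open>v x0 = 0\<close>.\<close>

lemma no_interior_zero_max:
  fixes v :: "real ^ 'n::finite \<Rightarrow> real"
  assumes N: "CARD('n) \<ge> 3" and \<Omega>: "open \<Omega>" and r: "0 < r" "cball x0 r \<subseteq> \<Omega>"
    and v: "continuous_on \<Omega> v" "\<And>x. x \<in> \<Omega> \<Longrightarrow> v x \<le> 0" "v x0 = 0" and c: "0 < c"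
    and sub: "\<And>\<phi>. \<phi> \<in> test_functions \<Omega> \<Longrightarrow> (\<And>x. 0 \<le> \<phi> x) \<Longrightarrow> (\<And>x. x \<notin> cball x0 r \<Longrightarrow> \<phi> x = 0) \<Longrightarrow>
      c * (LINT x|lebesgue_on \<Omega>. \<phi> x) \<le> (LINT x|lebesgue_on \<Omega>. v x * (\<Sum>i\<in>UNIV. partial_derivs [i, i] \<phi> x))"
  shows False
proof -
  define N where "N = real CARD('n)"
  \<comment> \<open>The cut-off makes \<open>- v\<close> bounded and Borel on the whole space, as
    the limit lemma requires, and leaves it unchanged near \<open>x0\<close>.\<close>
  define g where "g x = (if x \<in> cball x0 r then - v x else 0)" for x
  define B where "B \<delta> x = \<delta> * ((norm (x - x0))\<^sup>2 + \<delta>) powr - (N / 2 + 1)" for \<delta> and x :: "real ^ 'n"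
  have vc: "continuous_on (cball x0 r) v" using v(1) r(2) by (rule continuous_on_subset)
  have x0: "x0 \<in> \<Omega>" using r by auto
  obtain M where M: "\<And>x. x \<in> cball x0 r \<Longrightarrow> norm (v x) \<le> M"
    using compact_imp_bounded[OF compact_continuous_image[OF vc compact_cball]] unfolding bounded_iff by blast
  have M0: "0 \<le> M" using M[of x0] r(1) by auto
  have g_bound: "\<bar>g x\<bar> \<le> M" for x using M[of x] M0 by (auto simp: g_def)
  have g_nonneg: "0 \<le> g x" for x using v(2) r(2) by (auto simp: g_def)
  have g_meas: "g \<in> borel_measurable borel"
  proof -
    have "(\<lambda>x. indicator (cball x0 r) x *\<^sub>R - v x) \<in> borel_measurable borel"
      using vc by (intro borel_measurable_continuous_on_indicator continuous_on_minus) auto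
    also have "(\<lambda>x. indicator (cball x0 r) x *\<^sub>R - v x) = g"
      by (auto simp: g_def indicator_def fun_eq_iff)
    finally show ?thesis .
  qed
  have g_cont: "isCont g x0"
  proof -
    have "continuous_on (ball x0 r) (\<lambda>x. - v x)"
      using continuous_on_subset[OF vc ball_subset_cball] by (rule continuous_on_minus)
    then have "continuous_on (ball x0 r) g"
      by (rule continuous_on_eq) (auto simp: g_def)
    then show ?thesis using r(1) by (simp add: continuous_on_eq_continuous_at)
  qed
  \<comment> \<open>The sequence starts at \<open>r / 2\<close>, so that
    \<open>\<delta> = (t n)^2\<close> never exceeds the \<open>r^2 / 4\<close> allowed by
    \<open>trunc_kernel_ge\<close>.\<close>
  define t where "t n = r / (2 * real (Suc n))" for n
  have t_pos: "0 < t n" for n using r(1) by (simp add: t_def)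
  have t_le: "(t n)\<^sup>2 \<le> r\<^sup>2 / 4" for n
  proof -
    have "r / (2 * real (Suc n)) \<le> r / 2"
      using r(1) by (intro divide_left_mono) auto
    then have "(t n)\<^sup>2 \<le> (r / 2)\<^sup>2"
      using t_pos[of n] by (intro power_mono) (auto simp: t_def)
    then show ?thesis by (simp add: power_divide)
  qed
  have t_lim: "t \<longlonglongrightarrow> 0"
  proof -
    have "(\<lambda>n. (r / 2) * inverse (real (Suc n))) \<longlonglongrightarrow> (r / 2) * 0"
      by (intro tendsto_mult tendsto_const LIMSEQ_inverse_real_of_nat)
    then show ?thesis by (simp add: t_def[abs_def] field_simps)
  qed
  define \<phi> where "\<phi> n = trunc_kernel x0 r ((t n)\<^sup>2)" for n
  have t2: "0 < (t n)\<^sup>2" for n using t_pos[of n] by simp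
  have \<phi>: "\<phi> n \<in> test_functions \<Omega>" "0 \<le> \<phi> n x" "x \<notin> cball x0 r \<Longrightarrow> \<phi> n x = 0" for n x
    unfolding \<phi>_def
    using trunc_kernel_in_test_functions[OF N r(1) t2 r(2)] trunc_kernel_nonneg
      trunc_kernel_eq_0[OF N r(1) t2] by auto
  define \<kappa> where "\<kappa> = ramp ((r\<^sup>2 / 2) powr (1 - N / 2) - (r\<^sup>2) powr (1 - N / 2))"
  have \<kappa>: "0 < \<kappa>"
  proof -
    have "(r\<^sup>2) powr (1 - N / 2) < (r\<^sup>2 / 2) powr (1 - N / 2)"
      using N r(1) by (intro powr_less_mono2_neg) (auto simp: N_def)
    then show ?thesis unfolding \<kappa>_def by (intro ramp_pos) simp
  qed
  let ?V = "measure lborel (cball x0 (r / 2))"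
  have V: "0 < ?V" using r(1) content_cball_pos[of "r / 2" x0] by simp
  have lower: "\<kappa> * ?V \<le> (LINT x|lebesgue_on \<Omega>. \<phi> n x)" for n
  proof -
    have cont: "continuous_on UNIV (\<phi> n)"
      using \<phi>(1)[of n] smooth_fun_partial_derivs(2)[of "\<phi> n" UNIV "[]"]
      by (simp add: test_functions_def partial_derivs_def)
    have meas: "\<phi> n \<in> borel_measurable borel" by (rule borel_measurable_continuous_onI[OF cont])
    have 0: "\<phi> n x = 0" if "x \<notin> \<Omega>" for x using that \<phi>(3) r(2) by blast
    have int: "integrable lborel (\<phi> n)"
      by (rule integrable_lborel_compact_support[OF cont compact_cball \<phi>(3)])
    have "\<kappa> * ?V = (\<integral>x. indicator (cball x0 (r / 2)) x *\<^sub>R \<kappa> \<partial>lborel)"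
      by simp
    also have "\<dots> \<le> (\<integral>x. \<phi> n x \<partial>lborel)"
    proof (rule integral_mono)
      show "integrable lborel (\<lambda>x. indicator (cball x0 (r / 2)) x *\<^sub>R \<kappa>)"
        by (intro borel_integrable_compact) auto
      show "indicator (cball x0 (r / 2)) x *\<^sub>R \<kappa> \<le> \<phi> n x" for x
        using trunc_kernel_ge[OF N r(1) t2 t_le, of x x0 n] \<phi>(2)[of n x]
        by (cases "x \<in> cball x0 (r / 2)") (auto simp: \<kappa>_def N_def \<phi>_def)
    qed fact
    also have "\<dots> = (LINT x|lebesgue_on \<Omega>. \<phi> n x)"
      using \<Omega> by (intro integral_lebesgue_on_eq_lborel(1)[symmetric] meas 0) auto
    finally show ?thesis .
  qed
  have upper: "(LINT x|lebesgue_on \<Omega>. v x * (\<Sum>i\<in>UNIV. partial_derivs [i, i] (\<phi> n) x))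
      \<le> N * (N - 2) * (\<integral>x. g x * B ((t n)\<^sup>2) x \<partial>lborel)" for n
  proof -
    define L where "L x = (\<Sum>i\<in>UNIV. partial_derivs [i, i] (\<phi> n) x)" for x
    have sm: "smooth_fun (\<phi> n)" using \<phi>(1) by (simp add: test_functions_def)
    have L0: "L x = 0" if "x \<notin> cball x0 r" for x
      unfolding L_def using that \<phi>(3)
      by (intro sum.neutral ballI partial_derivs_eq_0[of "cball x0 r"]) auto
    have "continuous_on S L" for S
      unfolding L_def[abs_def] by (intro continuous_on_sum smooth_fun_partial_derivs(2)[OF sm])
    then have cont: "continuous_on UNIV (\<lambda>x. v x * L x)"
      using v(1) L0 by (intro continuous_on_extend_0[OF \<Omega> _ closed_cball r(2)] continuous_on_mult) auto
    have meas: "(\<lambda>x. v x * L x) \<in> borel_measurable borel" by (rule borel_measurable_continuous_onI[OF cont])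
    have int: "integrable lborel (\<lambda>x. v x * L x)"
      by (rule integrable_lborel_compact_support[OF cont compact_cball[of x0 r]]) (simp add: L0)
    have \<Omega>0: "v x * L x = 0" if "x \<notin> \<Omega>" for x
      using subsetD[OF r(2), of x] that L0[of x] by (cases "x \<in> cball x0 r") auto
    have B_meas: "B ((t n)\<^sup>2) \<in> borel_measurable borel"
      unfolding B_def[abs_def] by measurable
    have B_nonneg: "0 \<le> B ((t n)\<^sup>2) x" for x by (simp add: B_def)
    define b where "b = (t n)\<^sup>2 * ((t n)\<^sup>2) powr - (N / 2 + 1)"
    have B_le: "B ((t n)\<^sup>2) x \<le> b" for x
      unfolding B_def b_def using t2[of n] by (intro mult_left_mono powr_mono2') (auto simp: N_def)
    have int': "integrable lborel (\<lambda>x. g x * B ((t n)\<^sup>2) x)"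
    proof (rule Bochner_Integration.integrable_bound)
      show "integrable lborel (\<lambda>x. indicator (cball x0 r) x *\<^sub>R (M * b))"
        by (intro borel_integrable_compact) auto
      show "(\<lambda>x. g x * B ((t n)\<^sup>2) x) \<in> borel_measurable lborel"
        using g_meas B_meas by simp
      show "AE x in lborel. norm (g x * B ((t n)\<^sup>2) x) \<le> norm (indicator (cball x0 r) x *\<^sub>R (M * b))"
      proof (rule AE_I2)
        fix x
        have "\<bar>g x\<bar> * B ((t n)\<^sup>2) x \<le> M * b"
          by (intro mult_mono g_bound B_le B_nonneg M0)
        then have "\<bar>g x * B ((t n)\<^sup>2) x\<bar> \<le> \<bar>M * b\<bar>"
          using B_nonneg[of x] abs_ge_self[of "M * b"] by (simp only: abs_mult abs_of_nonneg)
        then show "norm (g x * B ((t n)\<^sup>2) x) \<le> norm (indicator (cball x0 r) x *\<^sub>R (M * b))"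
          by (cases "x \<in> cball x0 r") (auto simp: g_def)
      qed
    qed
    have "(LINT x|lebesgue_on \<Omega>. v x * L x) = (\<integral>x. v x * L x \<partial>lborel)"
      using \<Omega> by (intro integral_lebesgue_on_eq_lborel(1) meas \<Omega>0) auto
    also have "\<dots> \<le> (\<integral>x. N * (N - 2) * (g x * B ((t n)\<^sup>2) x) \<partial>lborel)"
    proof (rule integral_mono[OF int])
      show "integrable lborel (\<lambda>x. N * (N - 2) * (g x * B ((t n)\<^sup>2) x))"
        using int' by (rule integrable_mult_right)
      \<comment> \<open>On the ball \<open>v * L = g * (- L)\<close> with \<open>g \<ge> 0\<close>,
        so the lower bound on the Laplacian of the kernel bounds the product from above.\<close>
      show "v x * L x \<le> N * (N - 2) * (g x * B ((t n)\<^sup>2) x)" for x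
      proof (cases "x \<in> cball x0 r")
        case True
        have "- L x \<le> N * (N - 2) * B ((t n)\<^sup>2) x"
          using trunc_kernel_laplacian_ge[OF N t2, of x0 r n x]
          by (simp add: L_def \<phi>_def N_def B_def)
        then have "g x * (- L x) \<le> g x * (N * (N - 2) * B ((t n)\<^sup>2) x)"
          by (rule mult_left_mono[OF _ g_nonneg])
        with True show ?thesis by (simp add: g_def mult_ac)
      next
        case False
        then show ?thesis by (simp add: L0 g_def)
      qed
    qed
    finally show ?thesis by (simp add: L_def)
  qed
  have "(\<lambda>n. \<integral>x. g x * B ((t n)\<^sup>2) x \<partial>lborel) \<longlonglongrightarrow> 0"
    using integral_concentrating_kernel_tendsto_0[OF g_meas g_bound g_cont _ t_pos t_lim] v(3)
    by (simp add: B_def N_def g_def)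
  then have "(\<lambda>n. N * (N - 2) * (\<integral>x. g x * B ((t n)\<^sup>2) x \<partial>lborel)) \<longlonglongrightarrow> N * (N - 2) * 0"
    by (intro tendsto_mult tendsto_const)
  moreover have "c * (\<kappa> * ?V) \<le> N * (N - 2) * (\<integral>x. g x * B ((t n)\<^sup>2) x \<partial>lborel)" for n
  proof -
    have "c * (\<kappa> * ?V) \<le> c * (LINT x|lebesgue_on \<Omega>. \<phi> n x)"
      using c lower by (intro mult_left_mono) auto
    also note sub[OF \<phi>, of n]
    also note upper
    finally show ?thesis .
  qed
  ultimately have "c * (\<kappa> * ?V) \<le> N * (N - 2) * 0"
    by (intro LIMSEQ_le_const) auto
  moreover have "0 < c * (\<kappa> * ?V)" using c \<kappa> V by simp
  ultimately show False by simp
qed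

subsection \<open>Classical Laplacians\<close>

lemma continuous_on_mult_test_function:
  assumes \<Omega>: "open \<Omega>" and \<phi>: "\<phi> \<in> test_functions \<Omega>" and g: "continuous_on \<Omega> g"
  shows "continuous_on UNIV (\<lambda>x. g x * partial_derivs \<alpha> \<phi> x)"
    and "integrable (lebesgue_on \<Omega>) (\<lambda>x. g x * partial_derivs \<alpha> \<phi> x)"
proof -
  obtain K where K: "compact K" "K \<subseteq> \<Omega>" "\<And>\<alpha> x. x \<notin> K \<Longrightarrow> partial_derivs \<alpha> \<phi> x = 0"
    using test_functions_D[OF \<phi>] by metis
  have sm: "smooth_fun \<phi>" using \<phi> by (simp add: test_functions_def)
  have 0: "g x * partial_derivs \<alpha> \<phi> x = 0" if "x \<notin> K" for x using K(3)[OF that] by simp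
  show cont: "continuous_on UNIV (\<lambda>x. g x * partial_derivs \<alpha> \<phi> x)"
    by (rule continuous_on_extend_0[OF \<Omega> _ compact_imp_closed[OF K(1)] K(2) 0])
      (intro continuous_on_mult g smooth_fun_partial_derivs(2)[OF sm])
  have meas: "(\<lambda>x. g x * partial_derivs \<alpha> \<phi> x) \<in> borel_measurable borel"
    by (rule borel_measurable_continuous_onI[OF cont])
  have \<Omega>0: "g x * partial_derivs \<alpha> \<phi> x = 0" if "x \<notin> \<Omega>" for x
    using 0[of x] subsetD[OF K(2), of x] that by argo
  have "\<Omega> \<in> sets lebesgue" using \<Omega> by simp
  from integral_lebesgue_on_eq_lborel(2)[OF this meas \<Omega>0]
    integrable_lborel_compact_support[OF cont K(1) 0]
  show "integrable (lebesgue_on \<Omega>) (\<lambda>x. g x * partial_derivs \<alpha> \<phi> x)" by simp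
qed

text \<open>The classical Laplacian through derivatives along the coordinate axes, with continuous
  first and second derivatives as witnesses: the data that the integration by parts consumes. Values
  of \<open>l\<close> are prescribed on \<Omega> alone.\<close>

definition has_laplacian :: "(real ^ 'n::finite) set \<Rightarrow> (real ^ 'n \<Rightarrow> real) \<Rightarrow> (real ^ 'n \<Rightarrow> real) \<Rightarrow> bool" where
  "has_laplacian \<Omega> w l \<longleftrightarrow> continuous_on \<Omega> w \<and> (\<exists>w1 w2.
     (\<forall>i. continuous_on \<Omega> (w1 i) \<and> continuous_on \<Omega> (w2 i)) \<and>
     (\<forall>i. \<forall>x\<in>\<Omega>. ((\<lambda>t. w (x + t *\<^sub>R axis i 1)) has_real_derivative w1 i x) (at 0)) \<and>
     (\<forall>i. \<forall>x\<in>\<Omega>. ((\<lambda>t. w1 i (x + t *\<^sub>R axis i 1)) has_real_derivative w2 i x) (at 0)) \<and>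
     (\<forall>x\<in>\<Omega>. l x = (\<Sum>i\<in>UNIV. w2 i x)))"

lemma has_laplacian_add:
  assumes "has_laplacian \<Omega> w l" "has_laplacian \<Omega> w' l'"
  shows "has_laplacian \<Omega> (\<lambda>x. w x + w' x) (\<lambda>x. l x + l' x)"
proof -
  obtain w1 w2 where 1: "continuous_on \<Omega> w" "\<forall>i. continuous_on \<Omega> (w1 i) \<and> continuous_on \<Omega> (w2 i)"
     "\<forall>i. \<forall>x\<in>\<Omega>. ((\<lambda>t. w (x + t *\<^sub>R axis i 1)) has_real_derivative w1 i x) (at 0)"
     "\<forall>i. \<forall>x\<in>\<Omega>. ((\<lambda>t. w1 i (x + t *\<^sub>R axis i 1)) has_real_derivative w2 i x) (at 0)"
     "\<forall>x\<in>\<Omega>. l x = (\<Sum>i\<in>UNIV. w2 i x)"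
    using assms(1) unfolding has_laplacian_def by blast
  obtain w1' w2' where 2: "continuous_on \<Omega> w'" "\<forall>i. continuous_on \<Omega> (w1' i) \<and> continuous_on \<Omega> (w2' i)"
     "\<forall>i. \<forall>x\<in>\<Omega>. ((\<lambda>t. w' (x + t *\<^sub>R axis i 1)) has_real_derivative w1' i x) (at 0)"
     "\<forall>i. \<forall>x\<in>\<Omega>. ((\<lambda>t. w1' i (x + t *\<^sub>R axis i 1)) has_real_derivative w2' i x) (at 0)"
     "\<forall>x\<in>\<Omega>. l' x = (\<Sum>i\<in>UNIV. w2' i x)"
    using assms(2) unfolding has_laplacian_def by blast
  show ?thesis
    unfolding has_laplacian_def
    by (intro conjI exI[of _ "\<lambda>i x. w1 i x + w1' i x"] exI[of _ "\<lambda>i x. w2 i x + w2' i x"] allI ballI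
        continuous_on_add DERIV_add)
      (use 1 2 in \<open>simp_all add: sum.distrib\<close>)
qed

lemma has_laplacian_cmult:
  assumes "has_laplacian \<Omega> w l"
  shows "has_laplacian \<Omega> (\<lambda>x. c * w x) (\<lambda>x. c * l x)"
proof -
  obtain w1 w2 where 1: "continuous_on \<Omega> w" "\<forall>i. continuous_on \<Omega> (w1 i) \<and> continuous_on \<Omega> (w2 i)"
     "\<forall>i. \<forall>x\<in>\<Omega>. ((\<lambda>t. w (x + t *\<^sub>R axis i 1)) has_real_derivative w1 i x) (at 0)"
     "\<forall>i. \<forall>x\<in>\<Omega>. ((\<lambda>t. w1 i (x + t *\<^sub>R axis i 1)) has_real_derivative w2 i x) (at 0)"
     "\<forall>x\<in>\<Omega>. l x = (\<Sum>i\<in>UNIV. w2 i x)"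
    using assms(1) unfolding has_laplacian_def by blast
  show ?thesis
    unfolding has_laplacian_def
    by (intro conjI exI[of _ "\<lambda>i x. c * w1 i x"] exI[of _ "\<lambda>i x. c * w2 i x"] allI ballI
        continuous_on_mult_left DERIV_cmult)
      (use 1 in \<open>simp_all add: sum_distrib_left\<close>)
qed

lemma has_laplacian_subset:
  assumes "has_laplacian \<Omega> w l" "\<Omega>' \<subseteq> \<Omega>"
  shows "has_laplacian \<Omega>' w l"
proof -
  obtain w1 w2 where 1: "continuous_on \<Omega> w" "\<forall>i. continuous_on \<Omega> (w1 i) \<and> continuous_on \<Omega> (w2 i)"
     "\<forall>i. \<forall>x\<in>\<Omega>. ((\<lambda>t. w (x + t *\<^sub>R axis i 1)) has_real_derivative w1 i x) (at 0)"
     "\<forall>i. \<forall>x\<in>\<Omega>. ((\<lambda>t. w1 i (x + t *\<^sub>R axis i 1)) has_real_derivative w2 i x) (at 0)"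
     "\<forall>x\<in>\<Omega>. l x = (\<Sum>i\<in>UNIV. w2 i x)"
    using assms(1) unfolding has_laplacian_def by blast
  have "continuous_on \<Omega>' w" "continuous_on \<Omega>' (w1 i)" "continuous_on \<Omega>' (w2 i)" for i
    using 1(1,2) assms(2) by (auto intro: continuous_on_subset)
  then show ?thesis
    unfolding has_laplacian_def
    using 1(3-5) assms(2) by (intro conjI exI[of _ w1] exI[of _ w2]) (simp_all add: subset_iff)
qed

lemma has_laplacian_integral:
  assumes \<Omega>: "open \<Omega>" and \<phi>: "\<phi> \<in> test_functions \<Omega>" and w: "has_laplacian \<Omega> w l"
  shows "(LINT x|lebesgue_on \<Omega>. w x * (\<Sum>i\<in>UNIV. partial_derivs [i, i] \<phi> x)) = (LINT x|lebesgue_on \<Omega>. l x * \<phi> x)"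
proof -
  obtain w1 w2 where 1: "continuous_on \<Omega> w" "\<forall>i. continuous_on \<Omega> (w1 i) \<and> continuous_on \<Omega> (w2 i)"
     "\<forall>i. \<forall>x\<in>\<Omega>. ((\<lambda>t. w (x + t *\<^sub>R axis i 1)) has_real_derivative w1 i x) (at 0)"
     "\<forall>i. \<forall>x\<in>\<Omega>. ((\<lambda>t. w1 i (x + t *\<^sub>R axis i 1)) has_real_derivative w2 i x) (at 0)"
     "\<forall>x\<in>\<Omega>. l x = (\<Sum>i\<in>UNIV. w2 i x)"
    using w unfolding has_laplacian_def by blast
  note W = 1(1) 1(2)[THEN spec, THEN conjunct1] 1(2)[THEN spec, THEN conjunct2] 1(3-5)[rule_format]
  have int: "integrable (lebesgue_on \<Omega>) (\<lambda>x. w2 i x * \<phi> x)" for i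
    using continuous_on_mult_test_function(2)[OF \<Omega> \<phi> W(3), of i "[]"] by (simp add: partial_derivs_def)
  have "(LINT x|lebesgue_on \<Omega>. w x * (\<Sum>i\<in>UNIV. partial_derivs [i, i] \<phi> x))
      = (\<Sum>i\<in>UNIV. (LINT x|lebesgue_on \<Omega>. w x * partial_derivs [i, i] \<phi> x))"
    unfolding sum_distrib_left
    by (rule Bochner_Integration.integral_sum) (rule continuous_on_mult_test_function(2)[OF \<Omega> \<phi> W(1)])
  also have "\<dots> = (\<Sum>i\<in>UNIV. (LINT x|lebesgue_on \<Omega>. w2 i x * \<phi> x))"
    by (rule sum.cong[OF refl], rule integral_mult_second_partial_deriv[OF \<Omega> \<phi> W(1-5)])
  also have "\<dots> = (LINT x|lebesgue_on \<Omega>. (\<Sum>i\<in>UNIV. w2 i x * \<phi> x))"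
    by (rule Bochner_Integration.integral_sum[symmetric]) (rule int)
  also have "\<dots> = (LINT x|lebesgue_on \<Omega>. l x * \<phi> x)"
    by (rule Bochner_Integration.integral_cong[OF refl])
      (simp only: sum_distrib_right W(6) space_restrict_space space_completion space_lborel space_borel UNIV_I Int_iff)
  finally show ?thesis .
qed

section \<open>Laplacians of products of coordinate powers and radial powers\<close>

text \<open>This is \<open>x\<^sub>k^j |x| powr (- p)\<close>.\<close>

definition coord_radial :: "'n::finite \<Rightarrow> nat \<Rightarrow> real \<Rightarrow> real ^ 'n \<Rightarrow> real" where
  "coord_radial k j p x = (x $ k) ^ j * (x \<bullet> x) powr - (p / 2)"

text \<open>Along an axis \<open>x \<bullet> x\<close> becomes a quadratic polynomial in
  \<open>t\<close>. For \<open>j = 0\<close> the truncated \<open>j - 1\<close> is harmless because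
  its term carries the factor \<open>real j\<close>.\<close>

lemma coord_radial_directional_derivative:
  fixes x :: "real ^ 'n::finite"
  assumes "x \<noteq> 0"
  shows "((\<lambda>t. coord_radial k j p (x + t *\<^sub>R axis i 1)) has_real_derivative
    real j * of_bool (i = k) * coord_radial k (j - 1) p x - p * (x $ i * coord_radial k j (p + 2) x)) (at 0)"
proof -
  have inner: "(x + t *\<^sub>R axis i 1) \<bullet> (x + t *\<^sub>R axis i 1) = x \<bullet> x + 2 * t * x $ i + t\<^sup>2" for t
    by (simp add: inner_add_left inner_add_right inner_axis inner_axis' power2_eq_square algebra_simps)
  have comp: "(x + t *\<^sub>R axis i 1) $ k = x $ k + t * of_bool (i = k)" for t
    by (simp add: axis_def)
  have pos: "0 < x \<bullet> x" using assms by simp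
  have e: "(x \<bullet> x) powr (- (p / 2) - 1) = (x \<bullet> x) powr - ((p + 2) / 2)"
    by (rule arg_cong[where f="\<lambda>s. (x \<bullet> x) powr s"]) (simp add: field_simps)
  have "((\<lambda>t. (x $ k + t * of_bool (i = k)) ^ j * (x \<bullet> x + 2 * t * x $ i + t\<^sup>2) powr - (p / 2)) has_real_derivative
     (real j * of_bool (i = k) * (x $ k) ^ (j - 1)) * (x \<bullet> x) powr - (p / 2)
      + (x $ k) ^ j * (- (p / 2) * (x \<bullet> x) powr (- (p / 2) - 1) * (2 * x $ i))) (at 0)"
    using pos by (auto intro!: derivative_eq_intros)
  then show ?thesis
    unfolding coord_radial_def inner comp e by (simp add: algebra_simps)
qed

lemma continuous_on_coord_radial: "continuous_on (- {0}) (coord_radial k j p)"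
  unfolding coord_radial_def[abs_def] by (intro continuous_intros) auto

lemma coord_radial_shift:
  assumes "x \<noteq> 0"
  shows "(x \<bullet> x) * coord_radial k j (p + 2) x = coord_radial k j p x"
proof -
  have "(x \<bullet> x) powr - (p / 2) = (x \<bullet> x) powr (1 + - ((p + 2) / 2))"
    by (rule arg_cong[where f="\<lambda>s. (x \<bullet> x) powr s"]) (simp add: field_simps)
  also have "\<dots> = (x \<bullet> x) * (x \<bullet> x) powr - ((p + 2) / 2)"
    using assms by (subst powr_add) simp
  finally show ?thesis by (simp add: coord_radial_def)
qed

text \<open>The first term is the Laplacian of the coordinate power; in the second,
  \<open>p (N - 2 - p)\<close> comes from the radial power and \<open>2 p j\<close> from twice the
  product of the gradients. The index \<open>j - 2\<close> is truncated only where
  \<open>j (j - 1)\<close> vanishes.\<close>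

lemma coord_radial_laplacian:
  fixes k :: "'n::finite"
  shows "has_laplacian (- {0}) (coord_radial k j p)
    (\<lambda>x. real j * real (j - 1) * coord_radial k (j - 2) p x
       - p * (real CARD('n) + 2 * real j - 2 - p) * coord_radial k j (p + 2) x)"
proof -
  let ?h = "coord_radial k"
  let ?\<delta> = "\<lambda>i. of_bool (i = k) :: real"
  define w1 where "w1 i x = real j * ?\<delta> i * ?h (j - 1) p x - p * (x $ i * ?h j (p + 2) x)" for i x
  define w2 where "w2 i x = real j * ?\<delta> i * (real (j - 1) * ?\<delta> i * ?h (j - 1 - 1) p x - p * (x $ i * ?h (j - 1) (p + 2) x))
     - p * (?h j (p + 2) x + x $ i * (real j * ?\<delta> i * ?h (j - 1) (p + 2) x - (p + 2) * (x $ i * ?h j (p + 2 + 2) x)))" for i x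
  have D1: "((\<lambda>t. ?h j p (x + t *\<^sub>R axis i 1)) has_real_derivative w1 i x) (at 0)" if "x \<noteq> 0" for i x
    unfolding w1_def by (rule coord_radial_directional_derivative[OF that])
  have D2: "((\<lambda>t. w1 i (x + t *\<^sub>R axis i 1)) has_real_derivative w2 i x) (at 0)" if "x \<noteq> 0" for i x
  proof -
    have c: "((\<lambda>t. (x + t *\<^sub>R axis i 1) $ i) has_real_derivative 1) (at 0)"
      by (auto simp: axis_def intro!: derivative_eq_intros)
    note d = coord_radial_directional_derivative[OF that, of k _ _ i]
    show ?thesis
      unfolding w1_def w2_def
      by (rule DERIV_cong[OF DERIV_diff[OF DERIV_cmult[OF d[of "j - 1" p]]
          DERIV_cmult[OF DERIV_mult[OF c d[of j "p + 2"]]]]]) simp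
  qed
  have S: "real j * real (j - 1) * ?h (j - 2) p x - p * (real CARD('n) + 2 * real j - 2 - p) * ?h j (p + 2) x
      = (\<Sum>i\<in>UNIV. w2 i x)" if "x \<noteq> 0" for x
  proof -
    have j: "real j * (x $ k * ?h (j - 1) q x) = real j * ?h j q x" for q
      by (cases j) (auto simp: coord_radial_def)
    have xx: "(\<Sum>i\<in>UNIV. x $ i * x $ i) = x \<bullet> x" by (simp add: inner_vec_def)
    have w2: "w2 i x = ?\<delta> i * (real j * real (j - 1) * ?h (j - 2) p x) - ?\<delta> i * (2 * p * (real j * (x $ i * ?h (j - 1) (p + 2) x)))
       - p * ?h j (p + 2) x + x $ i * x $ i * (p * (p + 2) * ?h j (p + 2 + 2) x)" for i
      unfolding w2_def diff_diff_left one_add_one by (cases "i = k") (simp_all add: algebra_simps)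
    have "(\<Sum>i\<in>UNIV. w2 i x) = real j * real (j - 1) * ?h (j - 2) p x - 2 * p * (real j * ?h j (p + 2) x)
       - real CARD('n) * (p * ?h j (p + 2) x) + (x \<bullet> x) * (p * (p + 2) * ?h j (p + 2 + 2) x)"
      unfolding w2 by (simp add: sum.distrib sum_subtractf sum_distrib_right[symmetric] xx j of_bool_def if_distrib[of "\<lambda>c. c * _"] cong: if_cong)
        (use j[of "p + 2"] in auto)
    also have "(x \<bullet> x) * (p * (p + 2) * ?h j (p + 2 + 2) x) = p * (p + 2) * ?h j (p + 2) x"
      using coord_radial_shift[OF that, of k j "p + 2"] by (simp add: mult_ac)
    finally show ?thesis by (simp add: algebra_simps)
  qed
  have c1: "continuous_on (- {0}) (w1 i)" and c2: "continuous_on (- {0}) (w2 i)" for i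
    unfolding w1_def[abs_def] w2_def[abs_def]
    by (intro continuous_intros continuous_on_coord_radial)+
  show ?thesis
    unfolding has_laplacian_def
    using c1 c2 D1 D2 S continuous_on_coord_radial by (intro conjI exI[of _ w1] exI[of _ w2]) auto
qed

text \<open>Separates direction from size: in terms of \<open>s = x_k / |x|\<close>, the barrier
  inequalities become polynomial in \<open>s\<close>, up to powers of the norm.\<close>

lemma coord_radial_eq:
  assumes "x \<noteq> 0"
  shows "coord_radial k j p x = (x $ k / norm x) ^ j * norm x powr (real j - p)"
proof -
  have "(x \<bullet> x) powr - (p / 2) = norm x powr - p"
    using assms by (simp add: powr_powr flip: power2_norm_eq_inner powr_numeral)
  moreover have "norm x powr (real j - p) = norm x ^ j * norm x powr - p"
    using assms powr_add[of "norm x" "real j" "- p"] by (simp add: powr_realpow)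
  ultimately show ?thesis
    using assms by (simp add: coord_radial_def power_divide)
qed

lemma has_laplacian_continuous:
  assumes "has_laplacian \<Omega> w l"
  shows "continuous_on \<Omega> w" "continuous_on \<Omega> l"
proof -
  obtain w1 w2 where 1: "continuous_on \<Omega> w" "\<forall>i. continuous_on \<Omega> (w1 i) \<and> continuous_on \<Omega> (w2 i)"
     "\<forall>i. \<forall>x\<in>\<Omega>. ((\<lambda>t. w (x + t *\<^sub>R axis i 1)) has_real_derivative w1 i x) (at 0)"
     "\<forall>i. \<forall>x\<in>\<Omega>. ((\<lambda>t. w1 i (x + t *\<^sub>R axis i 1)) has_real_derivative w2 i x) (at 0)"
     "\<forall>x\<in>\<Omega>. l x = (\<Sum>i\<in>UNIV. w2 i x)"
    using assms unfolding has_laplacian_def by blast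
  show "continuous_on \<Omega> w" by (rule 1(1))
  have "continuous_on \<Omega> (\<lambda>x. \<Sum>i\<in>UNIV. w2 i x)"
    using 1(2) by (intro continuous_on_sum) simp
  then show "continuous_on \<Omega> l"
    by (rule continuous_on_eq) (simp add: 1(5))
qed

section \<open>Weak Laplacians against test functions\<close>

lemma Lp_loc_1_mult_test_function:
  assumes \<Omega>: "open \<Omega>" and \<phi>: "\<phi> \<in> test_functions \<Omega>" and f: "f \<in> Lp_loc 1 \<Omega>"
  shows "integrable (lebesgue_on \<Omega>) (\<lambda>x. f x * partial_derivs \<alpha> \<phi> x)"
proof -
  obtain S where S: "compact S" "S \<subseteq> \<Omega>" "\<And>\<alpha> x. x \<notin> S \<Longrightarrow> partial_derivs \<alpha> \<phi> x = 0"
    using test_functions_D[OF \<phi>] by metis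
  have sm: "smooth_fun \<phi>" using \<phi> by (simp add: test_functions_def)
  define \<psi> where "\<psi> = partial_derivs \<alpha> \<phi>"
  have \<psi>: "continuous_on S \<psi>" unfolding \<psi>_def by (rule smooth_fun_partial_derivs(2)[OF sm])
  have Sm: "S \<in> sets lebesgue" using S(1) by (simp add: compact_imp_closed lmeasurable_compact fmeasurableD)
  obtain B where B: "\<And>x. x \<in> S \<Longrightarrow> norm (\<psi> x) \<le> B"
    using compact_imp_bounded[OF compact_continuous_image[OF \<psi> S(1)]] unfolding bounded_iff by blast
  have f': "f \<in> borel_measurable (lebesgue_on S)" "integrable (lebesgue_on S) (\<lambda>x. \<bar>f x\<bar> powr 1)"
    using f S(1,2) unfolding Lp_loc_def by auto
  have "integrable (lebesgue_on S) f"
    using f' integrable_abs_iff[OF f'(1)] by simp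
  then have int: "integrable (lebesgue_on S) (\<lambda>x. B * f x)"
    by (rule integrable_mult_right)
  have "integrable (lebesgue_on S) (\<lambda>x. f x * \<psi> x)"
  proof (rule Bochner_Integration.integrable_bound[OF int])
    show "(\<lambda>x. f x * \<psi> x) \<in> borel_measurable (lebesgue_on S)"
      by (intro borel_measurable_times f'(1) continuous_imp_measurable_on_sets_lebesgue \<psi> Sm)
    show "AE x in lebesgue_on S. norm (f x * \<psi> x) \<le> norm (B * f x)"
    proof (rule AE_I2)
      fix x assume "x \<in> space (lebesgue_on S)"
      then have "\<bar>\<psi> x\<bar> \<le> B" using B[of x] by (simp add: space_restrict_space)
      then have "\<bar>f x\<bar> * \<bar>\<psi> x\<bar> \<le> \<bar>f x\<bar> * \<bar>B\<bar>" by (intro mult_left_mono) auto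
      then show "norm (f x * \<psi> x) \<le> norm (B * f x)" by (simp add: abs_mult mult.commute)
    qed
  qed
  then have "integrable lebesgue (\<lambda>x. indicator S x *\<^sub>R (f x * \<psi> x))"
    using Sm by (simp add: integrable_restrict_space)
  also have "(\<lambda>x. indicator S x *\<^sub>R (f x * \<psi> x)) = (\<lambda>x. indicator \<Omega> x *\<^sub>R (f x * \<psi> x))"
  proof
    fix x show "indicator S x *\<^sub>R (f x * \<psi> x) = indicator \<Omega> x *\<^sub>R (f x * \<psi> x)"
      using S(2) S(3)[of x \<alpha>] by (cases "x \<in> S") (auto simp: \<psi>_def indicator_def subset_iff)
  qed
  finally show ?thesis
    using \<Omega> by (simp add: integrable_restrict_space \<psi>_def)
qed

lemma weak_laplacian_integral:
  assumes \<Omega>: "open \<Omega>" and \<phi>: "\<phi> \<in> test_functions \<Omega>" and u: "u \<in> Sobolev_loc 2 p \<Omega>"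
  shows "integrable (lebesgue_on \<Omega>) (\<lambda>x. weak_laplacian \<Omega> u x * \<phi> x)"
    and "(LINT x|lebesgue_on \<Omega>. u x * (\<Sum>i\<in>UNIV. partial_derivs [i, i] \<phi> x))
      = (LINT x|lebesgue_on \<Omega>. weak_laplacian \<Omega> u x * \<phi> x)"
proof -
  have wd: "has_weak_deriv \<Omega> [i, i] u (weak_deriv \<Omega> [i, i] u)" for i
  proof -
    \<comment> \<open>Membership in the Sobolev space supplies a witness, so the representative
      chosen by \<open>weak_deriv\<close> really is a weak derivative.\<close>
    have "\<exists>v. has_weak_deriv \<Omega> [i, i] u v"
      using u unfolding Sobolev_loc_def by (auto dest: spec[of _ "[i, i]"])
    then show ?thesis unfolding weak_deriv_def by (rule someI_ex)
  qed
  have L: "u \<in> Lp_loc 1 \<Omega>" "weak_deriv \<Omega> [i, i] u \<in> Lp_loc 1 \<Omega>" for i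
    using wd unfolding has_weak_deriv_def by blast+
  have eq: "(LINT x|lebesgue_on \<Omega>. u x * partial_derivs [i, i] \<phi> x) =
        (LINT x|lebesgue_on \<Omega>. weak_deriv \<Omega> [i, i] u x * \<phi> x)" for i
    using wd[of i] \<phi> unfolding has_weak_deriv_def by simp
  have int: "integrable (lebesgue_on \<Omega>) (\<lambda>x. weak_deriv \<Omega> [i, i] u x * \<phi> x)" for i
    using Lp_loc_1_mult_test_function[OF \<Omega> \<phi> L(2), of i "[]"] by (simp add: partial_derivs_def)
  show "integrable (lebesgue_on \<Omega>) (\<lambda>x. weak_laplacian \<Omega> u x * \<phi> x)"
    unfolding weak_laplacian_def sum_distrib_right by (rule Bochner_Integration.integrable_sum) (rule int)
  have "(LINT x|lebesgue_on \<Omega>. u x * (\<Sum>i\<in>UNIV. partial_derivs [i, i] \<phi> x))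
      = (\<Sum>i\<in>UNIV. (LINT x|lebesgue_on \<Omega>. u x * partial_derivs [i, i] \<phi> x))"
    unfolding sum_distrib_left
    by (rule Bochner_Integration.integral_sum) (rule Lp_loc_1_mult_test_function[OF \<Omega> \<phi> L(1)])
  also have "\<dots> = (\<Sum>i\<in>UNIV. (LINT x|lebesgue_on \<Omega>. weak_deriv \<Omega> [i, i] u x * \<phi> x))"
    by (simp only: eq)
  also have "\<dots> = (LINT x|lebesgue_on \<Omega>. (\<Sum>i\<in>UNIV. weak_deriv \<Omega> [i, i] u x * \<phi> x))"
    by (rule Bochner_Integration.integral_sum[symmetric]) (rule int)
  finally show "(LINT x|lebesgue_on \<Omega>. u x * (\<Sum>i\<in>UNIV. partial_derivs [i, i] \<phi> x))
      = (LINT x|lebesgue_on \<Omega>. weak_laplacian \<Omega> u x * \<phi> x)"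
    by (simp only: weak_laplacian_def sum_distrib_right)
qed

subsection \<open>The barrier on the half space\<close>

text \<open>With \<open>s = x_k / |x|\<close> in \<open>(0, 1]\<close> and \<open>r = |x|\<close>, a
  power of \<open>r\<close> factors out of each inequality and a bound in \<open>s\<close> remains.
  The restriction \<open>r \<ge> r0\<close> keeps away from the origin, where the \<tau> term could
  outweigh the exact solution.\<close>

lemma half_space_barrier:
  fixes k :: "'n::finite"
  assumes a: "0 \<le> a" and b: "real CARD('n) / 2 - 1 - a < b" and r0: "0 < r0"
  obtains w l \<beta> \<eta> where "\<beta> < b" "0 < \<eta>" "has_laplacian (half_space k) w l"
    "\<And>x. x \<in> half_space k \<Longrightarrow> r0 \<le> norm x \<Longrightarrow> \<eta> * norm x powr - \<beta> \<le> w x"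
    "\<And>x. x \<in> half_space k \<Longrightarrow> r0 \<le> norm x \<Longrightarrow> \<eta> * norm x powr (- \<beta> - 2)
      \<le> - l x - ((real CARD('n))\<^sup>2 / 4 - a\<^sup>2) * (w x / (norm x)\<^sup>2)"
proof -
  define N where "N = real CARD('n)"
  define Kc where "Kc = N\<^sup>2 / 4 - a\<^sup>2"
  \<comment> \<open>The gap left by the hypothesis on \<open>b\<close>: with \<beta> as defined
    below, \<open>\<sigma> < d\<close> is the same as \<open>\<beta> < b\<close>.\<close>
  define d where "d = b - (N / 2 - 1 - a)"
  have d: "0 < d" using b by (simp add: d_def N_def)
  \<comment> \<open>The gain of \<open>x\<^sub>1 |x| powr (a - N/2 - \<sigma>)\<close> over the exact solution has the sign of
    \<open>2 a \<sigma> - \<sigma>\<^sup>2\<close>, which forces a negative coefficient when \<open>a = 0\<close>.\<close>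
  obtain \<tau> \<sigma> where \<tau>: "\<bar>\<tau>\<bar> \<le> (1::real)" and \<sigma>: "0 < \<sigma>" "\<sigma> < d" and gain: "0 < \<tau> * (2 * a * \<sigma> - \<sigma>\<^sup>2)"
  proof (cases "a = 0")
    case True
    show ?thesis by (rule that[of "-1" "d / 2"]) (use True d in auto)
  next
    case False
    define \<sigma> where "\<sigma> = min (2 * a) d / 2"
    have "0 < \<sigma>" "\<sigma> < 2 * a" "\<sigma> < d" using False a d by (auto simp: \<sigma>_def)
    moreover from this have "0 < \<sigma> * (2 * a - \<sigma>)" by simp
    ultimately show ?thesis by (intro that[of 1 \<sigma>]) (auto simp: power2_eq_square algebra_simps)
  qed
  define \<beta> where "\<beta> = N / 2 - 1 - a + \<sigma>"
  define \<kappa> where "\<kappa> = \<tau> * (2 * a * \<sigma> - \<sigma>\<^sup>2)"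
  \<comment> \<open>The Laplacian of the square of \<open>x_k\<close> supplies \<open>2 M\<close>,
    which lifts the coefficient of \<eta> to at least 1; \<open>c\<close> bounds the coefficient of
    the remaining \<open>s^2\<close> term. \<eta> is so small that
    \<open>\<eta> M c \<le> \<kappa>\<close>, whence the gain \<open>\<kappa> s\<close> absorbs the
    loss because \<open>s^2 \<le> s\<close>, and that \<open>\<eta> M \<le> 1\<close>, which serves
    the lower bound on \<open>w\<close>. \<open>A\<close> ensures
    \<open>A r powr \<sigma> \<ge> 2\<close> for \<open>r \<ge> r0\<close>, which outweighs
    \<open>\<tau> \<ge> - 1\<close>.\<close>
  define M where "M = (1 + \<bar>Kc - \<beta> * (N - 2 - \<beta>)\<bar>) / 2"
  define c where "c = \<bar>Kc - (\<beta> + 2) * (N - \<beta>)\<bar>"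
  define \<eta> where "\<eta> = min \<kappa> 1 / (M * (c + 1))"
  define A where "A = 2 * r0 powr - \<sigma>"
  have M: "0 < M" by (simp add: M_def add_pos_nonneg)
  have c: "0 \<le> c" by (simp add: c_def)
  have \<kappa>: "0 < \<kappa>" using gain by (simp add: \<kappa>_def)
  have \<eta>: "0 < \<eta>" using \<kappa> M c by (simp add: \<eta>_def)
  have \<eta>Mc: "\<eta> * M * c \<le> \<kappa>" and \<eta>M: "\<eta> * M \<le> 1"
  proof -
    have e: "\<eta> * M * (c + 1) = min \<kappa> 1" using M c by (simp add: \<eta>_def)
    have "0 < \<eta> * M" using \<eta> M by simp
    then have "\<eta> * M * c \<le> \<eta> * M * (c + 1)" "\<eta> * M * 1 \<le> \<eta> * M * (c + 1)"
      using c by (intro mult_left_mono; simp)+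
    then show "\<eta> * M * c \<le> \<kappa>" "\<eta> * M \<le> 1" unfolding e by auto
  qed
  let ?h = "coord_radial k"
  let ?l = "\<lambda>j p x. real j * real (j - 1) * ?h (j - 2) p x - p * (real CARD('n) + 2 * real j - 2 - p) * ?h j (p + 2) x"
  define w where "w x = A * ?h 1 (\<beta> + 1 - \<sigma>) x + (\<tau> * ?h 1 (\<beta> + 1) x + (\<eta> * ?h 0 \<beta> x + - (\<eta> * M) * ?h 2 (\<beta> + 2) x))" for x
  define l where "l x = A * ?l 1 (\<beta> + 1 - \<sigma>) x + (\<tau> * ?l 1 (\<beta> + 1) x + (\<eta> * ?l 0 \<beta> x + - (\<eta> * M) * ?l 2 (\<beta> + 2) x))" for x
  have "has_laplacian (- {0}) w l"
    unfolding w_def[abs_def] l_def[abs_def]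
    by (intro has_laplacian_add has_laplacian_cmult coord_radial_laplacian)
  moreover have sub: "half_space k \<subseteq> - {0}" by (auto simp: half_space_def)
  ultimately have lap: "has_laplacian (half_space k) w l" by (rule has_laplacian_subset)
  have H: "\<exists>s. 0 < s \<and> s \<le> 1 \<and> (\<forall>j p. ?h j p x = s ^ j * norm x powr (real j - p))" if "x \<in> half_space k" for x
  proof (intro exI conjI allI)
    have x0: "x \<noteq> 0" using that sub by auto
    show "0 < x $ k / norm x" using that x0 by (simp add: half_space_def)
    show "x $ k / norm x \<le> 1" using x0 component_le_norm_cart[of x k] by simp
    show "?h j p x = (x $ k / norm x) ^ j * norm x powr (real j - p)" for j p
      by (rule coord_radial_eq[OF x0])
  qed
  show ?thesis
  proof (rule that[OF _ \<eta> lap])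
    show "\<beta> < b" using \<sigma>(2) by (simp add: \<beta>_def d_def)
    fix x assume x: "x \<in> half_space k" "r0 \<le> norm x"
    obtain s where s: "0 < s" "s \<le> 1" and h: "\<And>j p. ?h j p x = s ^ j * norm x powr (real j - p)"
      using H[OF x(1)] by blast
    define r where "r = norm x"
    have r: "0 < r" "r0 \<le> r" using x r0 by (auto simp: r_def)
    have s2: "s\<^sup>2 \<le> s" using s by (simp add: power2_eq_square mult_left_le)
    have p1: "r powr (\<sigma> - \<beta>) = r powr \<sigma> * r powr - \<beta>"
      by (simp flip: powr_add)
    show "\<eta> * norm x powr - \<beta> \<le> w x"
    proof -
      have e: "w x = r powr - \<beta> * (s * (A * r powr \<sigma> + \<tau>) + \<eta> - \<eta> * M * s\<^sup>2)"
        unfolding w_def h r_def[symmetric] by (simp add: p1 algebra_simps)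
      have "r0 powr - \<sigma> * r0 powr \<sigma> \<le> r0 powr - \<sigma> * r powr \<sigma>"
        using r r0 \<sigma> by (intro mult_left_mono powr_mono2) auto
      moreover have "r0 powr - \<sigma> * r0 powr \<sigma> = 1" using r0 by (simp flip: powr_add)
      ultimately have "1 \<le> A * r powr \<sigma> + \<tau>" using \<tau> by (simp add: A_def)
      then have "s * 1 \<le> s * (A * r powr \<sigma> + \<tau>)" using s by (intro mult_left_mono) auto
      moreover have "\<eta> * M * s\<^sup>2 \<le> 1 * s"
        using \<eta>M s2 \<eta> M by (intro mult_mono) auto
      ultimately have "\<eta> \<le> s * (A * r powr \<sigma> + \<tau>) + \<eta> - \<eta> * M * s\<^sup>2" by simp
      then have "r powr - \<beta> * \<eta> \<le> w x" unfolding e by (rule mult_left_mono) simp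
      then show ?thesis by (simp add: r_def mult.commute)
    qed
    show "\<eta> * norm x powr (- \<beta> - 2) \<le> - l x - ((real CARD('n))\<^sup>2 / 4 - a\<^sup>2) * (w x / (norm x)\<^sup>2)"
    proof -
      let ?P = "r powr (- \<beta> - 2)"
      have dv: "?h j p x / r\<^sup>2 = ?h j (p + 2) x" for j p
      proof -
        have "r powr (real j - p) = r powr (real j - (p + 2)) * r powr 2"
          by (simp flip: powr_add)
        then show ?thesis using r(1) by (simp add: h r_def[symmetric])
      qed
      have wr: "w x / r\<^sup>2 = A * ?h 1 (\<beta> + 1 - \<sigma> + 2) x + (\<tau> * ?h 1 (\<beta> + 1 + 2) x + (\<eta> * ?h 0 (\<beta> + 2) x + - (\<eta> * M) * ?h 2 (\<beta> + 2 + 2) x))"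
        unfolding w_def add_divide_distrib times_divide_eq_right[symmetric] dv ..
      have hs: "?h 1 (\<beta> + 1 + 2) x = s * ?P" "?h 0 (\<beta> + 2) x = ?P" "?h 2 (\<beta> + 2 + 2) x = s\<^sup>2 * ?P"
        unfolding h r_def[symmetric] by (simp_all add: algebra_simps)
      have hs0: "?h (2 - 2) (\<beta> + 2) x = ?P" using hs(2) by simp
      define H1 where "H1 = ?h 1 (\<beta> + 1 - \<sigma> + 2) x"
      \<comment> \<open>Both identities are \<open>p (N - p) = N^2 / 4 - (N / 2 - p)^2\<close>: for
        \<open>p = N / 2 - a\<close> the first term solves the equation exactly, and for
        \<open>p = N / 2 - a + \<sigma>\<close> the surplus is
        \<open>2 a \<sigma> - \<sigma>^2\<close>.\<close>
      have z1: "(\<beta> + 1 - \<sigma>) * (N + 2 * 1 - 2 - (\<beta> + 1 - \<sigma>)) - Kc = 0"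
        by (simp add: \<beta>_def Kc_def power2_eq_square algebra_simps)
      have z2: "\<tau> * ((\<beta> + 1) * (N + 2 * 1 - 2 - (\<beta> + 1)) - Kc) = \<kappa>"
        by (simp add: \<beta>_def Kc_def \<kappa>_def power2_eq_square algebra_simps)
      have "- l x - Kc * (w x / r\<^sup>2)
         = A * H1 * ((\<beta> + 1 - \<sigma>) * (N + 2 * 1 - 2 - (\<beta> + 1 - \<sigma>)) - Kc)
           + \<tau> * ((\<beta> + 1) * (N + 2 * 1 - 2 - (\<beta> + 1)) - Kc) * (s * ?P)
           + \<eta> * ((\<beta> * (N - 2 - \<beta>) - Kc) + 2 * M) * ?P
           + \<eta> * M * (Kc - (\<beta> + 2) * (N - \<beta>)) * (s\<^sup>2 * ?P)"
        unfolding l_def wr N_def[symmetric] hs hs0 H1_def[symmetric] by (simp add: algebra_simps)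
      also have "\<dots> = ?P * (\<kappa> * s + \<eta> * ((\<beta> * (N - 2 - \<beta>) - Kc) + 2 * M) + \<eta> * M * ((Kc - (\<beta> + 2) * (N - \<beta>)) * s\<^sup>2))"
        unfolding z1 z2 by (simp add: algebra_simps)
      finally have e: "- l x - Kc * (w x / r\<^sup>2) = \<dots>" .
      have "\<eta> * 1 \<le> \<eta> * ((\<beta> * (N - 2 - \<beta>) - Kc) + 2 * M)"
      proof (rule mult_left_mono)
        have "2 * M = 1 + \<bar>Kc - \<beta> * (N - 2 - \<beta>)\<bar>" by (simp add: M_def)
        then show "1 \<le> (\<beta> * (N - 2 - \<beta>) - Kc) + 2 * M" by linarith
      qed (use \<eta> in simp)
      moreover have "- (\<kappa> * s) \<le> \<eta> * M * ((Kc - (\<beta> + 2) * (N - \<beta>)) * s\<^sup>2)"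
      proof -
        have "- c * s\<^sup>2 \<le> (Kc - (\<beta> + 2) * (N - \<beta>)) * s\<^sup>2"
          by (intro mult_right_mono) (auto simp: c_def)
        then have "\<eta> * M * (- c * s\<^sup>2) \<le> \<eta> * M * ((Kc - (\<beta> + 2) * (N - \<beta>)) * s\<^sup>2)"
          using \<eta> M by (intro mult_left_mono) auto
        moreover have "\<eta> * M * c * s\<^sup>2 \<le> \<kappa> * s"
          using \<eta>Mc s2 \<kappa> by (intro mult_mono) auto
        ultimately show ?thesis by simp
      qed
      ultimately have "\<eta> \<le> \<kappa> * s + \<eta> * ((\<beta> * (N - 2 - \<beta>) - Kc) + 2 * M) + \<eta> * M * ((Kc - (\<beta> + 2) * (N - \<beta>)) * s\<^sup>2)"
        by linarith
      then have "?P * \<eta> \<le> - l x - Kc * (w x / r\<^sup>2)"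
        unfolding e by (rule mult_left_mono) simp
      then show ?thesis by (simp add: r_def Kc_def N_def mult.commute)
    qed
  qed
qed

subsection \<open>The comparison argument\<close>

theorem theorem4p2:
  fixes \<Omega> :: "(real ^ 'n::finite) set" and k :: 'n
    and u :: "real ^ 'n \<Rightarrow> real" and a b C K :: real
  assumes "CARD('n) \<ge> 3"
    and "open \<Omega>" and "closure \<Omega> \<subseteq> half_space k"
    and "0 \<le> a" and "a < real CARD('n) / 2" and "0 \<le> b"
    and "u \<in> Sobolev_loc 2 (real CARD('n)) \<Omega>" and "continuous_on (closure \<Omega>) u"
    and "C > 0" and "K > 0"
    and "\<forall>x\<in>\<Omega>. u x \<le> C * norm x powr (- b)"
    and "AE x in lebesgue_on \<Omega>. - weak_laplacian \<Omega> u x \<le> K * (u x / (norm x)\<^sup>2)"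
    and "\<forall>x\<in>frontier \<Omega>. u x \<le> 0"
    and "K \<le> (real CARD('n))\<^sup>2 / 4 - a\<^sup>2"
    and "real CARD('n) < 2 * a + 2 * b + 2"
  shows "\<forall>x\<in>\<Omega>. u x \<le> 0"
proof (rule ccontr)
  assume "\<not> (\<forall>x\<in>\<Omega>. u x \<le> 0)"
  then obtain x1 where x1: "x1 \<in> \<Omega>" "0 < u x1" by (auto simp: not_le)
  note \<Omega> = assms(2)
  have \<Omega>_sub: "\<Omega> \<subseteq> half_space k" using assms(3) closure_subset by blast
  \<comment> \<open>The origin is not in the open half space, hence has positive distance
    \<open>r0\<close> from the closure of \<Omega>, and the barrier estimates hold on that
    closure.\<close>
  have "0 \<in> - closure \<Omega>" using assms(3) by (auto simp: half_space_def)
  then obtain r0 where r0: "0 < r0" "ball 0 r0 \<subseteq> - closure \<Omega>"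
    using open_contains_ball[of "- closure \<Omega>"] by auto
  have far: "r0 \<le> norm x" if "x \<in> closure \<Omega>" for x
  proof (rule ccontr)
    assume "\<not> r0 \<le> norm x"
    then have "x \<in> ball 0 r0" by simp
    with r0(2) that show False by blast
  qed
  define N where "N = real CARD('n)"
  define Kc where "Kc = N\<^sup>2 / 4 - a\<^sup>2"
  have b: "real CARD('n) / 2 - 1 - a < b" using assms(15) by linarith
  obtain w l \<beta> \<eta> where \<beta>: "\<beta> < b" and \<eta>: "0 < \<eta>" and lap: "has_laplacian (half_space k) w l"
    and w_ge': "\<And>x. x \<in> half_space k \<Longrightarrow> r0 \<le> norm x \<Longrightarrow> \<eta> * norm x powr - \<beta> \<le> w x"
    and l_ge': "\<And>x. x \<in> half_space k \<Longrightarrow> r0 \<le> norm x \<Longrightarrow> \<eta> * norm x powr (- \<beta> - 2)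
      \<le> - l x - ((real CARD('n))\<^sup>2 / 4 - a\<^sup>2) * (w x / (norm x)\<^sup>2)"
    by (rule half_space_barrier[OF assms(4) b r0(1), of k]) (rule that)
  have w_ge: "\<eta> * norm x powr - \<beta> \<le> w x" if "x \<in> closure \<Omega>" for x
    using w_ge'[of x] far[OF that] assms(3) that by blast
  have l_ge: "\<eta> * norm x powr (- \<beta> - 2) \<le> - l x - Kc * (w x / (norm x)\<^sup>2)" if "x \<in> closure \<Omega>" for x
    using l_ge'[of x] far[OF that] assms(3) that unfolding Kc_def N_def by blast
  have w_pos: "0 < w x" if "x \<in> closure \<Omega>" for x
  proof -
    have "0 < norm x" using far[OF that] r0(1) by linarith
    then have "0 < \<eta> * norm x powr - \<beta>" using \<eta> by simp
    also note w_ge[OF that]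
    finally show ?thesis .
  qed
  have lap\<Omega>: "has_laplacian \<Omega> w l" by (rule has_laplacian_subset[OF lap \<Omega>_sub])
  have cl: "x \<in> closure \<Omega>" if "x \<in> \<Omega>" for x using that closure_subset by blast
  define \<mu> where "\<mu> = u x1 / w x1"
  have \<mu>: "0 < \<mu>" using x1 w_pos[OF cl] by (simp add: \<mu>_def)
  \<comment> \<open>The growth bound on \<open>u\<close> and the lower bound on \<open>w\<close>
    give \<open>u / w \<le> (C / \<eta>) |x| powr (\<beta> - b)\<close>, which falls below \<mu>
    beyond radius \<open>R\<close> since \<open>\<beta> < b\<close>.\<close>
  obtain R where R: "\<And>r. R \<le> r \<Longrightarrow> r powr (\<beta> - b) < \<mu> * \<eta> / C"
  proof -
    have "((\<lambda>r. r powr (\<beta> - b)) \<longlongrightarrow> 0) at_top"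
      using \<beta> by (intro tendsto_neg_powr filterlim_ident) simp
    moreover have "0 < \<mu> * \<eta> / C" using \<mu> \<eta> assms(9) by simp
    ultimately have "\<forall>\<^sub>F r in at_top. r powr (\<beta> - b) < \<mu> * \<eta> / C" by (rule order_tendstoD(2))
    then show ?thesis using that by (auto simp: eventually_at_top_linorder)
  qed
  have decay: "u x < \<mu> * w x" if "x \<in> \<Omega>" "R \<le> norm x" for x
  proof -
    have pos: "0 < norm x" using far[OF cl[OF that(1)]] r0(1) by linarith
    have "C * norm x powr (\<beta> - b) < \<mu> * \<eta>"
      using R[OF that(2)] assms(9) by (simp add: field_simps)
    then have "norm x powr - \<beta> * (C * norm x powr (\<beta> - b)) < norm x powr - \<beta> * (\<mu> * \<eta>)"
      using pos by (intro mult_strict_left_mono) auto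
    moreover have "norm x powr - b = norm x powr - \<beta> * norm x powr (\<beta> - b)"
      by (simp flip: powr_add)
    ultimately have "C * norm x powr - b < \<mu> * (\<eta> * norm x powr - \<beta>)" by (simp add: mult_ac)
    also have "\<dots> \<le> \<mu> * w x" using w_ge[OF cl[OF that(1)]] \<mu> by simp
    finally show ?thesis using assms(11) that(1) by fastforce
  qed
  \<comment> \<open>The radius reaches both \<open>R\<close> and \<open>x1\<close>: the maximum of
    \<open>u / w\<close> over the compact set \<open>T\<close> is then at least \<mu>, while on the
    rest of \<Omega> the quotient is below \<mu>, so the maximum is global.\<close>
  define T where "T = closure \<Omega> \<inter> cball 0 (max R (norm x1))"
  have T: "compact T" by (simp add: T_def closed_Int_compact)
  have x1T: "x1 \<in> T" using x1 cl by (simp add: T_def)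
  have "continuous_on T (\<lambda>x. u x / w x)"
  proof (intro continuous_on_divide ballI)
    show "continuous_on T u" using assms(8) by (rule continuous_on_subset) (simp add: T_def)
    show "continuous_on T w"
      using has_laplacian_continuous(1)[OF lap] by (rule continuous_on_subset) (use assms(3) in \<open>auto simp: T_def\<close>)
    show "w x \<noteq> 0" if "x \<in> T" for x using w_pos[of x] that by (simp add: T_def)
  qed
  then obtain x0 where x0: "x0 \<in> T" "\<And>x. x \<in> T \<Longrightarrow> u x / w x \<le> u x0 / w x0"
    using continuous_attains_sup[OF T] x1T by blast
  define m where "m = u x0 / w x0"
  have \<mu>m: "\<mu> \<le> m" using x0(2)[OF x1T] by (simp add: m_def \<mu>_def)
  then have m: "0 < m" using \<mu> by simp
  have x0cl: "x0 \<in> closure \<Omega>" using x0(1) by (simp add: T_def)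
  have ux0: "0 < u x0" using m w_pos[OF x0cl] by (simp add: m_def zero_less_divide_iff)
  have x0\<Omega>: "x0 \<in> \<Omega>"
  proof (rule ccontr)
    assume "x0 \<notin> \<Omega>"
    with x0cl have "x0 \<in> frontier \<Omega>" using \<Omega> by (simp add: frontier_def interior_open)
    then show False using assms(13) ux0 by fastforce
  qed
  have u_le: "u x \<le> m * w x" if "x \<in> \<Omega>" for x
  proof (cases "x \<in> T")
    case True
    then have "u x / w x \<le> m" using x0(2) by (simp add: m_def)
    then show ?thesis using w_pos[OF cl[OF that]] by (simp add: pos_divide_le_eq)
  next
    case False
    then have "R \<le> norm x" using cl[OF that] by (auto simp: T_def)
    from decay[OF that this] have "u x < \<mu> * w x" .
    also have "\<dots> \<le> m * w x" using \<mu>m w_pos[OF cl[OF that]] by simp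
    finally show ?thesis by simp
  qed
  obtain r where r: "0 < r" "cball x0 r \<subseteq> \<Omega>" using \<Omega> x0\<Omega> by (auto simp: open_contains_cball)
  have nz: "norm x \<noteq> 0" if "x \<in> \<Omega>" for x using far[OF cl[OF that]] r0(1) by auto
  \<comment> \<open>The strictness of the barrier is made uniform on the ball: the minimum of its
    surplus there, times \<open>m\<close>, is the constant \<open>c\<close>.\<close>
  have "continuous_on (cball x0 r) (\<lambda>x. \<eta> * norm x powr (- \<beta> - 2))"
    using nz r(2) by (intro continuous_intros) auto
  moreover have "cball x0 r \<noteq> {}" using r(1) by simp
  ultimately obtain y where y: "y \<in> cball x0 r" "\<And>x. x \<in> cball x0 r \<Longrightarrow> \<eta> * norm y powr (- \<beta> - 2) \<le> \<eta> * norm x powr (- \<beta> - 2)"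
    using continuous_attains_inf[OF compact_cball] by blast
  define c where "c = m * (\<eta> * norm y powr (- \<beta> - 2))"
  have c: "0 < c" using m \<eta> nz[of y] y(1) r(2) by (auto simp: c_def)
  define v where "v x = u x - m * w x" for x
  show False
  proof (rule no_interior_zero_max[OF assms(1) \<Omega> r, of v c])
    show "continuous_on \<Omega> v"
      unfolding v_def[abs_def]
      using has_laplacian_continuous(1)[OF lap\<Omega>] continuous_on_subset[OF assms(8) closure_subset]
      by (intro continuous_intros)
    show "v x \<le> 0" if "x \<in> \<Omega>" for x using u_le[OF that] by (simp add: v_def)
    show "v x0 = 0" using w_pos[OF x0cl] by (simp add: v_def m_def)
    show "0 < c" by fact
    fix \<phi> assume \<phi>: "\<phi> \<in> test_functions \<Omega>" "\<And>x. 0 \<le> \<phi> x" "\<And>x. x \<notin> cball x0 r \<Longrightarrow> \<phi> x = 0"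
    let ?M = "lebesgue_on \<Omega>"
    let ?\<Delta> = "\<lambda>x. \<Sum>i\<in>UNIV. partial_derivs [i, i] \<phi> x"
    note U = weak_laplacian_integral[OF \<Omega> \<phi>(1) assms(7)]
    note W = has_laplacian_integral[OF \<Omega> \<phi>(1) lap\<Omega>]
    have u_cont: "continuous_on \<Omega> u" using continuous_on_subset[OF assms(8) closure_subset] .
    have int\<Delta>: "integrable ?M (\<lambda>x. g x * ?\<Delta> x)" if "continuous_on \<Omega> g" for g
      unfolding sum_distrib_left
      by (rule Bochner_Integration.integrable_sum) (rule continuous_on_mult_test_function(2)[OF \<Omega> \<phi>(1) that])
    have int: "integrable ?M (\<lambda>x. g x * \<phi> x)" if "continuous_on \<Omega> g" for g
      using continuous_on_mult_test_function(2)[OF \<Omega> \<phi>(1) that, of "[]"] by (simp add: partial_derivs_def)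
    have l\<phi>: "integrable ?M (\<lambda>x. m * (l x * \<phi> x))"
      by (intro integrable_mult_right int has_laplacian_continuous(2)[OF lap\<Omega>])
    have "c * (LINT x|?M. \<phi> x) = (LINT x|?M. c * \<phi> x)" by simp
    also have "\<dots> \<le> (LINT x|?M. weak_laplacian \<Omega> u x * \<phi> x - m * (l x * \<phi> x))"
    proof (rule integral_mono_AE)
      show "integrable ?M (\<lambda>x. c * \<phi> x)" by (rule int) (rule continuous_on_const)
      show "integrable ?M (\<lambda>x. weak_laplacian \<Omega> u x * \<phi> x - m * (l x * \<phi> x))"
        by (rule Bochner_Integration.integrable_diff[OF U(1) l\<phi>])
      show "AE x in ?M. c * \<phi> x \<le> weak_laplacian \<Omega> u x * \<phi> x - m * (l x * \<phi> x)"
        using assms(12) AE_space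
      proof eventually_elim
        case (elim x)
        then have x: "x \<in> \<Omega>" by (simp add: space_restrict_space)
        show ?case
        proof (cases "x \<in> cball x0 r")
          case True
          have n2: "0 < (norm x)\<^sup>2" using nz[OF x] by simp
          \<comment> \<open>\<open>u\<close> is first replaced by \<open>m w\<close>, using
            \<open>K > 0\<close>; since \<open>m w\<close> is positive while \<open>u\<close> may be
            negative, \<open>K\<close> is raised to \<open>Kc\<close> only afterwards.\<close>
          have "K * (u x / (norm x)\<^sup>2) \<le> K * (m * w x / (norm x)\<^sup>2)"
            using assms(10) u_le[OF x] n2 by (intro mult_left_mono divide_right_mono) auto
          also have "\<dots> \<le> Kc * (m * w x / (norm x)\<^sup>2)"
            using assms(14) m w_pos[OF cl[OF x]] n2 by (intro mult_right_mono) (auto simp: Kc_def N_def)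
          finally have "- (Kc * (m * w x / (norm x)\<^sup>2)) \<le> weak_laplacian \<Omega> u x"
            using elim(1) by linarith
          moreover have "c \<le> m * (- l x - Kc * (w x / (norm x)\<^sup>2))"
            unfolding c_def using m y(2)[OF True] l_ge[OF cl[OF x]] by (intro mult_left_mono) auto
          ultimately have "c \<le> weak_laplacian \<Omega> u x - m * l x" by (simp add: algebra_simps)
          from mult_right_mono[OF this \<phi>(2)[of x]] show ?thesis by (simp add: algebra_simps)
        next
          case False
          then show ?thesis using \<phi>(3)[OF False] by simp
        qed
      qed
    qed
    \<comment> \<open>Both Laplacians move onto \<phi>: that of \<open>u\<close> by the definition
      of weak derivatives, that of \<open>w\<close> by the classical integration by parts.\<close>
    also have "\<dots> = (LINT x|?M. u x * ?\<Delta> x) - m * (LINT x|?M. w x * ?\<Delta> x)"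
      unfolding U(2) W by (subst Bochner_Integration.integral_diff[OF U(1) l\<phi>]) simp
    also have "\<dots> = (LINT x|?M. u x * ?\<Delta> x - m * (w x * ?\<Delta> x))"
      using int\<Delta>[OF u_cont] integrable_mult_right[OF int\<Delta>[OF has_laplacian_continuous(1)[OF lap\<Omega>]], of m]
      by (subst Bochner_Integration.integral_diff) simp_all
    also have "\<dots> = (LINT x|?M. v x * ?\<Delta> x)"
      by (rule Bochner_Integration.integral_cong[OF refl]) (simp add: v_def left_diff_distrib)
    finally show "c * (LINT x|?M. \<phi> x) \<le> (LINT x|?M. v x * ?\<Delta> x)" .
  qed
qed

end
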